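(* Let $n\in\{1,2,\dots\}$ or $n=\infty$. Let $T:=[T_1,\dots,T_n]$, $T_i\in B(\mathcal H)$, be a row contraction and let $V:=[V_1,\dots,V_n]$, $V_i\in B(\mathcal K)$, be an isometric lifting of $T$ on a Hilbert space $\mathcal K\supseteq\mathcal H$. Let $\mathcal X$ be a Hilbert space, let $\mathcal X_i\subseteq\mathcal X$, $i=1,\dots,n$, be (pairwise) orthogonal subspaces and let $R_i\in B(\mathcal X_i,\mathcal X)$ be contractions. If $A\in B(\mathcal X,\mathcal H)$ is a contraction, then there is a contraction $B\in B(\mathcal X,\mathcal K)$ such that $P_{\mathcal H}B=A$ and $$\|V_iBR_i-B|_{\mathcal X_i}\|\le\sqrt2\,\big\|[T_1AR_1-A|_{\mathcal X_1},\ \dots,\ T_nAR_n-A|_{\mathcal X_n}]\big\|^{1/2}$$ for every $i=1,\dots,n$. Moreover, $\sqrt2$ is the best possible constant, i.e. it cannot be replaced by a smaller constant for which the result holds for all such data.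
   Context: All spaces are complex Hilbert spaces, subspaces are closed; $B(\mathcal X,\mathcal H)$ denotes the bounded linear operators from $\mathcal X$ to $\mathcal H$ and $B(\mathcal H)=B(\mathcal H,\mathcal H)$. $P_{\mathcal H}$ is the orthogonal projection of $\mathcal K$ onto $\mathcal H$. A row contraction is a sequence $[T_1,\dots,T_n]$ with $T_i\in B(\mathcal H)$ and $T_1T_1^*+\cdots+T_nT_n^*\le I_{\mathcal H}$. An isometric lifting of $T$ on $\mathcal K\supseteq\mathcal H$ is a sequence $[V_1,\dots,V_n]$, $V_i\in B(\mathcal K)$, with $V_i^*V_j=\delta_{ij}I_{\mathcal K}$ and $P_{\mathcal H}V_i=T_iP_{\mathcal H}$ for all $i,j$. For operators $M_i\in B(\mathcal X_i,\mathcal H)$, $[M_1,\dots,M_n]$ denotes the row operator $\bigoplus_{i=1}^n\mathcal X_i\to\mathcal H$, $\oplus_i h_i\mapsto\sum_i M_ih_i$. *)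

theory Defs
  imports "HOL-Analysis.Analysis"
begin

section \<open>Complex Hilbert spaces\<close>

text \<open>
  The inner product is linear in the first argument. The underlying real structure is that of
  \<^class>\<open>real_inner\<close>, so norm and topology are the ones induced by the complex inner product:
  \<open>norm x = sqrt (Re (cinner x x))\<close>. Completeness comes from \<^class>\<open>banach\<close>.
\<close>

class complex_hilbert_space = real_inner + banach +
  fixes scaleC :: "complex \<Rightarrow> 'a \<Rightarrow> 'a"
    and cinner :: "'a \<Rightarrow> 'a \<Rightarrow> complex"
  assumes scaleC_add_right: "scaleC a (x + y) = scaleC a x + scaleC a y"
    and scaleC_add_left: "scaleC (a + b) x = scaleC a x + scaleC b x"
    and scaleC_scaleC: "scaleC a (scaleC b x) = scaleC (a * b) x"
    and scaleR_eq_scaleC: "scaleR r x = scaleC (complex_of_real r) x"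
    and cinner_commute: "cinner x y = cnj (cinner y x)"
    and cinner_add_left: "cinner (x + y) z = cinner x z + cinner y z"
    and cinner_scaleC_left: "cinner (scaleC a x) y = a * cinner x y"
    and inner_eq_Re_cinner: "inner x y = Re (cinner x y)"

text \<open>``Subspace'' always means closed complex-linear subspace.\<close>

definition closed_csubspace :: "'a::complex_hilbert_space set \<Rightarrow> bool" where
  "closed_csubspace M \<longleftrightarrow>
     closed M \<and> 0 \<in> M \<and> (\<forall>x\<in>M. \<forall>y\<in>M. x + y \<in> M) \<and> (\<forall>a. \<forall>x\<in>M. scaleC a x \<in> M)"

definition orthogonal_spaces :: "'a::complex_hilbert_space set \<Rightarrow> 'a set \<Rightarrow> bool" where
  "orthogonal_spaces M N \<longleftrightarrow> (\<forall>x\<in>M. \<forall>y\<in>N. cinner x y = 0)"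

definition ortho_proj :: "'a::complex_hilbert_space set \<Rightarrow> 'a \<Rightarrow> 'a" where
  "ortho_proj M x = (THE y. y \<in> M \<and> (\<forall>z\<in>M. cinner (x - y) z = 0))"

section \<open>Bounded operators between subspaces\<close>

text \<open>
  An operator in \<open>B(M, N)\<close>, for closed subspaces \<open>M\<close> and \<open>N\<close>, is represented by a total function
  of which only the values on \<open>M\<close> matter; every notion below looks at it on \<open>M\<close> only.
\<close>

definition bounded_op :: "'a::complex_hilbert_space set \<Rightarrow> 'b::complex_hilbert_space set \<Rightarrow> ('a \<Rightarrow> 'b) \<Rightarrow> bool" where
  "bounded_op M N f \<longleftrightarrow>
     (\<forall>x\<in>M. f x \<in> N) \<and>
     (\<forall>x\<in>M. \<forall>y\<in>M. f (x + y) = f x + f y) \<and>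
     (\<forall>a. \<forall>x\<in>M. f (scaleC a x) = scaleC a (f x)) \<and>
     (\<exists>b. \<forall>x\<in>M. norm (f x) \<le> b * norm x)"

definition op_norm :: "'a::complex_hilbert_space set \<Rightarrow> ('a \<Rightarrow> 'b::complex_hilbert_space) \<Rightarrow> real" where
  "op_norm M f = (SUP x\<in>{x\<in>M. norm x \<le> 1}. norm (f x))"

definition contraction_op :: "'a::complex_hilbert_space set \<Rightarrow> 'b::complex_hilbert_space set \<Rightarrow> ('a \<Rightarrow> 'b) \<Rightarrow> bool" where
  "contraction_op M N f \<longleftrightarrow> bounded_op M N f \<and> op_norm M f \<le> 1"

definition adjoint_op :: "'a::complex_hilbert_space set \<Rightarrow> ('a \<Rightarrow> 'b::complex_hilbert_space) \<Rightarrow> 'b \<Rightarrow> 'a" where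
  "adjoint_op M f y = (THE x. x \<in> M \<and> (\<forall>z\<in>M. cinner (f z) y = cinner z x))"

section \<open>Row operators, row contractions, isometric liftings\<close>

definition index_set :: "enat \<Rightarrow> nat set" where
  "index_set n = {i. 1 \<le> i \<and> enat i \<le> n}"

text \<open>The Hilbert space direct sum of the \<open>X i\<close>, and its norm.\<close>

definition direct_sum :: "nat set \<Rightarrow> (nat \<Rightarrow> 'a::complex_hilbert_space set) \<Rightarrow> (nat \<Rightarrow> 'a) set" where
  "direct_sum I X =
     {x. (\<forall>i\<in>I. x i \<in> X i) \<and> (\<forall>i. i \<notin> I \<longrightarrow> x i = 0) \<and> (\<lambda>i. (norm (x i))\<^sup>2) summable_on I}"

definition direct_sum_norm :: "nat set \<Rightarrow> (nat \<Rightarrow> 'a::complex_hilbert_space) \<Rightarrow> real" where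
  "direct_sum_norm I x = sqrt (\<Sum>\<^sub>\<infinity>i\<in>I. (norm (x i))\<^sup>2)"

definition row_op :: "nat set \<Rightarrow> (nat \<Rightarrow> 'a \<Rightarrow> 'b::complex_hilbert_space) \<Rightarrow> (nat \<Rightarrow> 'a) \<Rightarrow> 'b" where
  "row_op I M x = (\<Sum>\<^sub>\<infinity>i\<in>I. M i (x i))"

definition row_norm :: "nat set \<Rightarrow> (nat \<Rightarrow> 'a::complex_hilbert_space set) \<Rightarrow>
    (nat \<Rightarrow> 'a \<Rightarrow> 'b::complex_hilbert_space) \<Rightarrow> real" where
  "row_norm I X M =
     (SUP x\<in>{x\<in>direct_sum I X. direct_sum_norm I x \<le> 1}. norm (row_op I M x))"

text \<open>
  For infinite \<open>I\<close> the series of the \<open>T i (T i)\<^sup>*\<close> converges in the strong operator topology.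
\<close>

definition row_contraction :: "nat set \<Rightarrow> 'a::complex_hilbert_space set \<Rightarrow> (nat \<Rightarrow> 'a \<Rightarrow> 'a) \<Rightarrow> bool" where
  "row_contraction I H T \<longleftrightarrow>
     (\<forall>i\<in>I. bounded_op H H (T i)) \<and>
     (\<forall>h\<in>H. (\<lambda>i. T i (adjoint_op H (T i) h)) summable_on I \<and>
        Re (cinner (\<Sum>\<^sub>\<infinity>i\<in>I. T i (adjoint_op H (T i) h)) h) \<le> Re (cinner h h))"

definition isometric_lifting :: "nat set \<Rightarrow> 'a::complex_hilbert_space set \<Rightarrow>
    (nat \<Rightarrow> 'a \<Rightarrow> 'a) \<Rightarrow> (nat \<Rightarrow> 'a \<Rightarrow> 'a) \<Rightarrow> bool" where
  "isometric_lifting I H T V \<longleftrightarrow>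
     (\<forall>i\<in>I. bounded_op UNIV UNIV (V i)) \<and>
     (\<forall>i\<in>I. \<forall>j\<in>I. \<forall>x. adjoint_op UNIV (V i) (V j x) = (if i = j then x else 0)) \<and>
     (\<forall>i\<in>I. \<forall>x. ortho_proj H (V i x) = T i (ortho_proj H x))"

text \<open>
  The standing hypotheses. The spaces \<open>\<K>\<close> and \<open>\<X>\<close> are the types \<open>'k\<close> and \<open>'x\<close>; \<open>\<H>\<close> is a closed
  subspace of \<open>\<K>\<close>.
\<close>

definition lifting_data :: "enat \<Rightarrow> 'k::complex_hilbert_space set \<Rightarrow> (nat \<Rightarrow> 'k \<Rightarrow> 'k) \<Rightarrow> (nat \<Rightarrow> 'k \<Rightarrow> 'k) \<Rightarrow>
    (nat \<Rightarrow> 'x::complex_hilbert_space set) \<Rightarrow> (nat \<Rightarrow> 'x \<Rightarrow> 'x) \<Rightarrow> ('x \<Rightarrow> 'k) \<Rightarrow> bool" where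
  "lifting_data n H T V X R A \<longleftrightarrow>
     closed_csubspace H \<and>
     row_contraction (index_set n) H T \<and>
     isometric_lifting (index_set n) H T V \<and>
     (\<forall>i\<in>index_set n. closed_csubspace (X i)) \<and>
     (\<forall>i\<in>index_set n. \<forall>j\<in>index_set n. i \<noteq> j \<longrightarrow> orthogonal_spaces (X i) (X j)) \<and>
     (\<forall>i\<in>index_set n. contraction_op (X i) UNIV (R i)) \<and>
     contraction_op UNIV H A"

section \<open>The Hilbert space of square-summable sequences\<close>

typedef ell2 = "{x :: nat \<Rightarrow> complex. summable (\<lambda>i. (cmod (x i))\<^sup>2)}"
  morphisms ell2_nth Abs_ell2
  by (rule exI[of _ "\<lambda>_. 0"]) simp

lemma summable_ell2_nth: "summable (\<lambda>i. (cmod (ell2_nth x i))\<^sup>2)"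
  using ell2_nth[of x] by simp

lemma ell2_nth_Abs: "summable (\<lambda>i. (cmod (f i))\<^sup>2) \<Longrightarrow> ell2_nth (Abs_ell2 f) = f"
  by (simp add: Abs_ell2_inverse)

lemma ell2_eqI: "(\<And>i. ell2_nth x i = ell2_nth y i) \<Longrightarrow> x = y"
  by (metis ell2_nth_inject ext)

lemma cmod_add_sq_le: "(cmod (a + b))\<^sup>2 \<le> 2 * (cmod a)\<^sup>2 + 2 * (cmod b)\<^sup>2"
proof -
  have "(cmod (a + b))\<^sup>2 \<le> (cmod a + cmod b)\<^sup>2"
    by (rule power_mono[OF norm_triangle_ineq]) simp
  also have "\<dots> \<le> 2 * (cmod a)\<^sup>2 + 2 * (cmod b)\<^sup>2"
    using sum_squares_bound[of "cmod a" "cmod b"] by (simp add: power2_sum)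
  finally show ?thesis .
qed

lemma summable_sq_add:
  assumes "summable (\<lambda>i. (cmod (f i))\<^sup>2)" "summable (\<lambda>i. (cmod (g i))\<^sup>2)"
  shows "summable (\<lambda>i. (cmod (f i + g i))\<^sup>2)"
  by (rule summable_comparison_test'[where N = 0, OF summable_add[OF
        summable_mult[OF assms(1), of 2] summable_mult[OF assms(2), of 2]]])
     (simp add: cmod_add_sq_le)

lemma summable_sq_mult:
  assumes "summable (\<lambda>i. (cmod (f i))\<^sup>2)"
  shows "summable (\<lambda>i. (cmod (a * f i))\<^sup>2)"
  using summable_mult[OF assms, of "(cmod a)\<^sup>2"] by (simp add: norm_mult power_mult_distrib)

lemma summable_sq_diff:
  assumes "summable (\<lambda>i. (cmod (f i))\<^sup>2)" "summable (\<lambda>i. (cmod (g i))\<^sup>2)"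
  shows "summable (\<lambda>i. (cmod (f i - g i))\<^sup>2)"
  using summable_sq_add[OF assms(1) summable_sq_mult[OF assms(2), of "-1"]] by simp

lemma summable_ell2_prod: "summable (\<lambda>i. ell2_nth x i * cnj (ell2_nth y i))"
proof (rule summable_comparison_test'[where N = 0, OF summable_add[OF summable_ell2_nth[of x] summable_ell2_nth[of y]]])
  fix i
  have "2 * (cmod (ell2_nth x i) * cmod (ell2_nth y i)) \<le> (cmod (ell2_nth x i))\<^sup>2 + (cmod (ell2_nth y i))\<^sup>2"
    using sum_squares_bound[of "cmod (ell2_nth x i)" "cmod (ell2_nth y i)"] by simp
  moreover have "0 \<le> cmod (ell2_nth x i) * cmod (ell2_nth y i)" by simp
  ultimately show "norm (ell2_nth x i * cnj (ell2_nth y i)) \<le> (cmod (ell2_nth x i))\<^sup>2 + (cmod (ell2_nth y i))\<^sup>2"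
    unfolding norm_mult complex_mod_cnj by linarith
qed

instantiation ell2 :: real_vector
begin

definition zero_ell2 where "0 = Abs_ell2 (\<lambda>_. 0)"
definition plus_ell2 where "x + y = Abs_ell2 (\<lambda>i. ell2_nth x i + ell2_nth y i)"
definition minus_ell2 where "x - y = Abs_ell2 (\<lambda>i. ell2_nth x i - ell2_nth y i)"
definition uminus_ell2 where "- x = Abs_ell2 (\<lambda>i. - ell2_nth x i)"
definition scaleR_ell2 where "scaleR r x = Abs_ell2 (\<lambda>i. complex_of_real r * ell2_nth x i)"

lemma ell2_nth_simps [simp]:
  "ell2_nth 0 i = 0"
  "ell2_nth (x + y) i = ell2_nth x i + ell2_nth y i"
  "ell2_nth (x - y) i = ell2_nth x i - ell2_nth y i"
  "ell2_nth (- x) i = - ell2_nth x i"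
  "ell2_nth (scaleR r x) i = complex_of_real r * ell2_nth x i"
  using summable_ell2_nth[of x] summable_ell2_nth[of y] summable_sq_mult[of "ell2_nth x" "complex_of_real r"]
  by (simp_all add: zero_ell2_def plus_ell2_def minus_ell2_def uminus_ell2_def scaleR_ell2_def
      ell2_nth_Abs summable_sq_add summable_sq_diff)

instance
proof
  fix x y z :: ell2 and a b :: real
  show "x + y + z = x + (y + z)" "x + y = y + x" "0 + x = x" "- x + x = 0" "x - y = x + - y"
    "a *\<^sub>R (x + y) = a *\<^sub>R x + a *\<^sub>R y" "(a + b) *\<^sub>R x = a *\<^sub>R x + b *\<^sub>R x"
    "a *\<^sub>R b *\<^sub>R x = (a * b) *\<^sub>R x" "1 *\<^sub>R x = x"
    by (auto intro!: ell2_eqI simp: algebra_simps)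
qed

end

instantiation ell2 :: real_inner
begin

definition inner_ell2 where "inner x y = Re (\<Sum>i. ell2_nth x i * cnj (ell2_nth y i))"
definition norm_ell2 where "norm (x :: ell2) = sqrt (inner x x)"
definition sgn_ell2 where "sgn (x :: ell2) = x /\<^sub>R norm x"
definition dist_ell2 where "dist (x :: ell2) y = norm (x - y)"
definition uniformity_ell2 where
  "(uniformity :: (ell2 \<times> ell2) filter) = (INF e\<in>{0<..}. principal {(x, y). dist x y < e})"
definition open_ell2 where
  "open (U :: ell2 set) \<longleftrightarrow> (\<forall>x\<in>U. eventually (\<lambda>(x', y). x' = x \<longrightarrow> y \<in> U) uniformity)"

lemma inner_ell2_self: "inner x x = (\<Sum>i. (cmod (ell2_nth x i))\<^sup>2)"
proof -
  have "(\<Sum>i. ell2_nth x i * cnj (ell2_nth x i)) = (\<Sum>i. complex_of_real ((cmod (ell2_nth x i))\<^sup>2))"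
    by (simp only: complex_norm_square)
  also have "\<dots> = complex_of_real (\<Sum>i. (cmod (ell2_nth x i))\<^sup>2)"
    by (rule suminf_of_real[symmetric, OF summable_ell2_nth])
  finally show ?thesis by (simp add: inner_ell2_def)
qed

instance
proof
  fix x y z :: ell2 and r :: real
  show "dist x y = norm (x - y)" by (rule dist_ell2_def)
  show "sgn x = x /\<^sub>R norm x" by (rule sgn_ell2_def)
  show "(uniformity :: (ell2 \<times> ell2) filter) = (INF e\<in>{0<..}. principal {(x, y). dist x y < e})"
    by (rule uniformity_ell2_def)
  show "open U \<longleftrightarrow> (\<forall>x\<in>U. eventually (\<lambda>(x', y). x' = x \<longrightarrow> y \<in> U) uniformity)" for U :: "ell2 set"
    by (rule open_ell2_def)
  show "inner x y = inner y x"
    unfolding inner_ell2_def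
    by (simp add: Re_suminf[OF summable_ell2_prod] mult.commute)
  show "inner (x + y) z = inner x z + inner y z"
    unfolding inner_ell2_def
    by (simp add: distrib_right suminf_add[OF summable_ell2_prod summable_ell2_prod, symmetric])
  show "inner (r *\<^sub>R x) y = r * inner x y"
    unfolding inner_ell2_def
    by (simp add: mult.assoc suminf_mult[OF summable_ell2_prod])
  show "0 \<le> inner x x"
    unfolding inner_ell2_self by (rule suminf_nonneg[OF summable_ell2_nth]) simp
  show "inner x x = 0 \<longleftrightarrow> x = 0"
  proof
    assume "inner x x = 0"
    then have "\<forall>i. (cmod (ell2_nth x i))\<^sup>2 = 0"
      unfolding inner_ell2_self by (subst (asm) suminf_eq_zero_iff[OF summable_ell2_nth]) simp_all
    then show "x = 0" by (auto intro!: ell2_eqI)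
  qed (simp add: inner_ell2_self)
  show "norm x = sqrt (inner x x)" by (rule norm_ell2_def)
qed

end

lemma norm_ell2_sq: "(norm (x :: ell2))\<^sup>2 = (\<Sum>i. (cmod (ell2_nth x i))\<^sup>2)"
  by (metis dot_square_norm inner_ell2_self)

lemma sum_ell2_le: "(\<Sum>i<k. (cmod (ell2_nth x i))\<^sup>2) \<le> (norm x)\<^sup>2"
  unfolding norm_ell2_sq by (rule sum_le_suminf[OF summable_ell2_nth]) simp_all

lemma cmod_ell2_nth_le: "cmod (ell2_nth x i) \<le> norm x"
proof -
  have "(cmod (ell2_nth x i))\<^sup>2 \<le> (\<Sum>j<Suc i. (cmod (ell2_nth x j))\<^sup>2)"
    by (rule member_le_sum) auto
  also have "\<dots> \<le> (norm x)\<^sup>2" by (rule sum_ell2_le)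
  finally show ?thesis by (rule power2_le_imp_le) simp
qed

instance ell2 :: banach
proof
  fix X :: "nat \<Rightarrow> ell2"
  assume X: "Cauchy X"
  have "convergent (\<lambda>n. ell2_nth (X n) i)" for i
  proof -
    have "Cauchy (\<lambda>n. ell2_nth (X n) i)"
    proof (rule metric_CauchyI)
      fix e :: real assume "0 < e"
      with metric_CauchyD[OF X] obtain N where N: "\<forall>m\<ge>N. \<forall>n\<ge>N. dist (X m) (X n) < e" by blast
      have "dist (ell2_nth (X m) i) (ell2_nth (X n) i) < e" if "m \<ge> N" "n \<ge> N" for m n
        using cmod_ell2_nth_le[of "X m - X n" i] N that by (fastforce simp: dist_norm)
      then show "\<exists>N. \<forall>m\<ge>N. \<forall>n\<ge>N. dist (ell2_nth (X m) i) (ell2_nth (X n) i) < e" by blast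
    qed
    then show ?thesis by (rule Cauchy_convergent)
  qed
  then obtain L where L: "\<And>i. (\<lambda>n. ell2_nth (X n) i) \<longlonglongrightarrow> L i"
    unfolding convergent_def by metis
  have bound: "\<exists>N. \<forall>m\<ge>N. \<forall>k. (\<Sum>i<k. (cmod (ell2_nth (X m) i - L i))\<^sup>2) \<le> e\<^sup>2" if "e > 0" for e :: real
  proof -
    from metric_CauchyD[OF X that] obtain N where N: "\<forall>m\<ge>N. \<forall>n\<ge>N. dist (X m) (X n) < e" by blast
    have "(\<Sum>i<k. (cmod (ell2_nth (X m) i - L i))\<^sup>2) \<le> e\<^sup>2" if m: "m \<ge> N" for m k
    proof (rule tendsto_upperbound)
      show "(\<lambda>n. \<Sum>i<k. (cmod (ell2_nth (X m) i - ell2_nth (X n) i))\<^sup>2)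
              \<longlonglongrightarrow> (\<Sum>i<k. (cmod (ell2_nth (X m) i - L i))\<^sup>2)"
        by (intro tendsto_intros L)
      have "(\<Sum>i<k. (cmod (ell2_nth (X m) i - ell2_nth (X n) i))\<^sup>2) \<le> e\<^sup>2" if "n \<ge> N" for n
      proof -
        have "(\<Sum>i<k. (cmod (ell2_nth (X m) i - ell2_nth (X n) i))\<^sup>2) \<le> (norm (X m - X n))\<^sup>2"
          using sum_ell2_le[of "X m - X n" k] by simp
        also have "\<dots> \<le> e\<^sup>2"
          using N m that by (intro power_mono) (auto simp: dist_norm intro: less_imp_le)
        finally show ?thesis .
      qed
      then show "\<forall>\<^sub>F n in sequentially. (\<Sum>i<k. (cmod (ell2_nth (X m) i - ell2_nth (X n) i))\<^sup>2) \<le> e\<^sup>2"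
        by (auto simp: eventually_sequentially)
    qed simp
    then show ?thesis by blast
  qed
  have summ: "summable (\<lambda>i. (cmod (ell2_nth (X m) i - L i))\<^sup>2)"
    if "\<forall>k. (\<Sum>i<k. (cmod (ell2_nth (X m) i - L i))\<^sup>2) \<le> B" for m B
    using that by (intro summableI_nonneg_bounded[where x = B]) auto
  obtain m where m: "summable (\<lambda>i. (cmod (ell2_nth (X m) i - L i))\<^sup>2)"
    using bound[of 1] summ by fastforce
  have "summable (\<lambda>i. (cmod (L i))\<^sup>2)"
    using summable_sq_diff[OF summable_ell2_nth[of "X m"] m] by simp
  then have nth: "ell2_nth (Abs_ell2 L) = L" by (rule ell2_nth_Abs)
  have "X \<longlonglongrightarrow> Abs_ell2 L"
  proof (rule metric_LIMSEQ_I)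
    fix r :: real assume "0 < r"
    then obtain N where N: "\<forall>m\<ge>N. \<forall>k. (\<Sum>i<k. (cmod (ell2_nth (X m) i - L i))\<^sup>2) \<le> (r / 2)\<^sup>2"
      using bound[of "r / 2"] by auto
    have "dist (X n) (Abs_ell2 L) < r" if "n \<ge> N" for n
    proof -
      have *: "\<forall>k. (\<Sum>i<k. (cmod (ell2_nth (X n) i - L i))\<^sup>2) \<le> (r / 2)\<^sup>2" using N that by blast
      have "(norm (X n - Abs_ell2 L))\<^sup>2 = (\<Sum>i. (cmod (ell2_nth (X n) i - L i))\<^sup>2)"
        by (simp add: norm_ell2_sq nth)
      also have "\<dots> \<le> (r / 2)\<^sup>2"
        by (rule suminf_le_const[OF summ[OF *]]) (use * in blast)
      finally have "norm (X n - Abs_ell2 L) \<le> r / 2"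
        by (rule power2_le_imp_le) (use \<open>0 < r\<close> in simp)
      with \<open>0 < r\<close> show ?thesis by (simp add: dist_norm)
    qed
    then show "\<exists>N. \<forall>n\<ge>N. dist (X n) (Abs_ell2 L) < r" by blast
  qed
  then show "convergent X" by (rule convergentI)
qed

instantiation ell2 :: complex_hilbert_space
begin

definition scaleC_ell2 where "scaleC a x = Abs_ell2 (\<lambda>i. a * ell2_nth x i)"
definition cinner_ell2 where "cinner x y = (\<Sum>i. ell2_nth x i * cnj (ell2_nth y i))"

lemma ell2_nth_scaleC [simp]: "ell2_nth (scaleC a x) i = a * ell2_nth x i"
  by (simp add: scaleC_ell2_def ell2_nth_Abs summable_sq_mult summable_ell2_nth)

instance
proof
  fix x y z :: ell2 and a b :: complex and r :: real
  show "scaleC a (x + y) = scaleC a x + scaleC a y" "scaleC (a + b) x = scaleC a x + scaleC b x"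
    "scaleC a (scaleC b x) = scaleC (a * b) x" "r *\<^sub>R x = scaleC (complex_of_real r) x"
    by (auto intro!: ell2_eqI simp: algebra_simps)
  have "(\<lambda>i. cnj (ell2_nth y i * cnj (ell2_nth x i))) sums cnj (\<Sum>i. ell2_nth y i * cnj (ell2_nth x i))"
    by (subst sums_cnj) (rule summable_sums[OF summable_ell2_prod])
  then show "cinner x y = cnj (cinner y x)"
    unfolding cinner_ell2_def by (simp add: mult.commute sums_iff)
  show "cinner (x + y) z = cinner x z + cinner y z"
    unfolding cinner_ell2_def
    by (simp add: distrib_right suminf_add[OF summable_ell2_prod summable_ell2_prod, symmetric])
  show "cinner (scaleC a x) y = a * cinner x y"
    unfolding cinner_ell2_def
    by (simp add: mult.assoc suminf_mult[OF summable_ell2_prod])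
  show "inner x y = Re (cinner x y)"
    by (simp add: inner_ell2_def cinner_ell2_def)
qed

end

end

theory Submission
  imports Defs
begin

text \<open>
  Let \<open>E y\<close> be the value of the row \<open>[T\<^sub>i A R\<^sub>i - A]\<close> at \<open>y = \<Sum>\<^sub>i y\<^sub>i\<close>, \<open>y\<^sub>i \<in> X\<^sub>i\<close>, and \<open>\<delta>\<close> its norm,
  which is at most \<open>2\<close>. With \<open>d x = \<parallel>x\<parallel>\<^sup>2 - \<parallel>A x\<parallel>\<^sup>2\<close> and \<open>e y = 2 \<delta> \<parallel>y\<parallel>\<^sup>2 - \<parallel>E y\<parallel>\<^sup>2 \<ge> 0\<close>, write
  \<open>B = A + \<beta>\<close> with \<open>\<beta>\<close> orthogonal to \<open>H\<close> and \<open>\<parallel>\<beta> x\<parallel>\<^sup>2 \<le> d x\<close>. The component of \<open>\<Sum>\<^sub>i V\<^sub>i B R\<^sub>i y\<^sub>i\<close>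
  orthogonal to \<open>H\<close> then has squared norm at most \<open>d y + e y\<close>, so (a commutant lifting argument)
  \<open>\<beta>\<close> can be chosen to agree with it up to an error of squared norm at most \<open>e y\<close>; adding the
  component \<open>E y\<close> in \<open>H\<close> gives the total squared error \<open>2 \<delta> \<parallel>y\<parallel>\<^sup>2\<close>. The construction is carried out
  real linearly and made complex linear at the end by averaging. The constant is attained when
  \<open>V\<^sub>1\<close> fixes a unit vector spanning \<open>H = X\<^sub>1\<close>, \<open>R\<^sub>1 = -1\<close> and \<open>A = P\<^sub>H\<close>: both sides are \<open>2\<close>.
\<close>

section \<open>Extension of operators dominated by a semi-inner product\<close>

text \<open>The maps to be extended are given by formulas that need not be linear off a subspace,
  while HOL functions are total; hence linearity relative to a set.\<close>

definition linear_on :: "'a::real_vector set \<Rightarrow> ('a \<Rightarrow> 'b::real_vector) \<Rightarrow> bool" where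
  "linear_on S f \<longleftrightarrow>
     (\<forall>x\<in>S. \<forall>y\<in>S. f (x + y) = f x + f y) \<and> (\<forall>c. \<forall>x\<in>S. f (c *\<^sub>R x) = c *\<^sub>R f x)"

lemma linear_onD:
  assumes "linear_on S f"
  shows "x \<in> S \<Longrightarrow> y \<in> S \<Longrightarrow> f (x + y) = f x + f y" "x \<in> S \<Longrightarrow> f (c *\<^sub>R x) = c *\<^sub>R f x"
  using assms by (auto simp: linear_on_def)

lemma linear_on_diff:
  assumes "linear_on S f" "subspace S" "x \<in> S" "y \<in> S"
  shows "f (x - y) = f x - f y"
proof -
  have "f (x + (-1) *\<^sub>R y) = f x + (-1) *\<^sub>R f y"
    using linear_onD[OF assms(1)] assms by (metis subspace_scale)
  then show ?thesis by simp
qed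

lemma linear_on_add:
  "linear_on S f \<Longrightarrow> linear_on S g \<Longrightarrow> linear_on S (\<lambda>x. f x + g x)"
  by (auto simp: linear_on_def algebra_simps)

text \<open>Degenerate forms must be allowed: \<open>\<parallel>x\<parallel>\<^sup>2 - \<parallel>A
  x\<parallel>\<^sup>2\<close> vanishes wherever the contraction \<open>A\<close> preserves the
  norm.\<close>

definition semi_inner :: "('v::real_vector \<Rightarrow> 'v \<Rightarrow> real) \<Rightarrow> bool" where
  "semi_inner b \<longleftrightarrow> (\<forall>w. linear (\<lambda>u. b u w)) \<and> (\<forall>u v. b u v = b v u) \<and> (\<forall>u. 0 \<le> b u u)"

section \<open>Semi-inner products and asymptotic projections\<close>

context
  fixes b :: "'v::real_vector \<Rightarrow> 'v \<Rightarrow> real"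
  assumes b: "semi_inner b"
begin

lemma semi_inner_add_left: "b (u + v) w = b u w + b v w"
  and semi_inner_diff_left: "b (u - v) w = b u w - b v w"
  and semi_inner_scale_left: "b (r *\<^sub>R u) w = r * b u w"
  and semi_inner_sym: "b u w = b w u"
  and semi_inner_nonneg: "0 \<le> b u u"
  using b unfolding semi_inner_def
  by (auto dest: linear_add linear_diff linear_scale simp: linear_add linear_diff linear_scale)

lemma semi_inner_add_right: "b w (u + v) = b w u + b w v"
  and semi_inner_diff_right: "b w (u - v) = b w u - b w v"
  and semi_inner_scale_right: "b w (r *\<^sub>R u) = r * b w u"
  using semi_inner_add_left semi_inner_diff_left semi_inner_scale_left semi_inner_sym by metis+

lemmas semi_inner_simps = semi_inner_add_left semi_inner_diff_left semi_inner_scale_left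
  semi_inner_add_right semi_inner_diff_right semi_inner_scale_right

text \<open>The quadratic \<open>b (u - t *\<^sub>R y) (u - t *\<^sub>R y) - m\<close> in
  \<open>t\<close> is nonnegative, so its discriminant is not positive. With \<open>m = 0\<close>
  this is Cauchy-Schwarz; with \<open>m\<close> a squared distance to a subspace it makes
  near-minimizers nearly orthogonal to that subspace.\<close>

lemma semi_inner_excess_bound:
  assumes "\<And>t. m \<le> b (u - t *\<^sub>R y) (u - t *\<^sub>R y)"
  shows "(b u y)\<^sup>2 \<le> (b u u - m) * b y y"
proof -
  have *: "2 * t * b u y \<le> (b u u - m) + t\<^sup>2 * b y y" for t
    using assms[of t] semi_inner_sym[of y u]
    by (simp add: semi_inner_simps power2_eq_square algebra_simps)
  show ?thesis
  proof (cases "b y y = 0")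
    case True
    have "b u y = 0"
    proof (rule ccontr)
      assume "b u y \<noteq> 0"
      \<comment> \<open>For \<open>b y y = 0\<close> the quadratic is affine in \<open>t\<close>;
        this \<open>t\<close> pushes its linear part past \<open>b u u - m\<close>, which is
        nonnegative.\<close>
      with *[of "(b u u - m + 1) / b u y"] True have "2 * (b u u - m + 1) \<le> b u u - m" by simp
      then have "b u u - m \<le> - 2" by simp
      moreover have "m \<le> b u u" using assms[of 0] by simp
      ultimately show False by simp
    qed
    with True show ?thesis by simp
  next
    case False
    then have pos: "b y y > 0" using semi_inner_nonneg[of y] by simp
    have "(b u y)\<^sup>2 / b y y \<le> b u u - m"
      using *[of "b u y / b y y"] pos by (simp add: power2_eq_square field_simps)
    with pos show ?thesis by (simp add: field_simps)
  qed
qed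

lemma semi_inner_Cauchy_Schwarz: "\<bar>b u y\<bar> \<le> sqrt (b u u) * sqrt (b y y)"
proof -
  have "(b u y)\<^sup>2 \<le> (b u u - 0) * b y y"
    by (rule semi_inner_excess_bound) (rule semi_inner_nonneg)
  then show ?thesis by (metis diff_zero real_sqrt_abs real_sqrt_le_mono real_sqrt_mult)
qed

text \<open>Stand-in for the orthogonal projection of \<open>v\<close> onto \<open>F\<close>, which
  need not exist as a vector since \<open>b\<close> may be degenerate and \<open>F\<close>
  incomplete: the residual becomes orthogonal to \<open>F\<close>, uniformly on the unit ball of the
  seminorm.\<close>

definition asymptotic_projection :: "'v set \<Rightarrow> 'v \<Rightarrow> (nat \<Rightarrow> 'v) \<Rightarrow> bool" where
  "asymptotic_projection F v s \<longleftrightarrow> (\<forall>n. s n \<in> F) \<and>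
     (\<exists>\<epsilon>. \<epsilon> \<longlonglongrightarrow> 0 \<and> (\<forall>n. \<forall>y\<in>F. \<bar>b (v - s n) y\<bar> \<le> \<epsilon> n * sqrt (b y y)))"

text \<open>A minimizing sequence for the distance from \<open>v\<close> to \<open>F\<close> works:
  moving \<open>s n\<close> inside \<open>F\<close> lowers the squared distance by less than
  \<open>1 / (n + 1)\<close>, which bounds the first-order term.\<close>

lemma asymptotic_projection_exists:
  assumes F: "subspace F"
  shows "\<exists>s. asymptotic_projection F v s"
proof -
  define m where "m = (INF y\<in>F. b (v - y) (v - y))"
  have bdd: "bdd_below ((\<lambda>y. b (v - y) (v - y)) ` F)"
    by (rule bdd_belowI2[where m = 0]) (rule semi_inner_nonneg)
  have low: "m \<le> b (v - y) (v - y)" if "y \<in> F" for y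
    unfolding m_def by (rule cINF_lower[OF bdd that])
  have "\<exists>y\<in>F. b (v - y) (v - y) < m + inverse (real (Suc n))" for n
    using cINF_less_iff[OF _ bdd, of "m + inverse (real (Suc n))"] subspace_0[OF F]
    by (auto simp: m_def[symmetric])
  then obtain s where s: "\<And>n. s n \<in> F"
    "\<And>n. b (v - s n) (v - s n) < m + inverse (real (Suc n))" by metis
  have "\<bar>b (v - s n) y\<bar> \<le> sqrt (inverse (real (Suc n))) * sqrt (b y y)" if "y \<in> F" for n y
  proof -
    have "(b (v - s n) y)\<^sup>2 \<le> (b (v - s n) (v - s n) - m) * b y y"
    proof (rule semi_inner_excess_bound)
      fix t
      have "s n + t *\<^sub>R y \<in> F" using s(1) that F by (simp add: subspace_add subspace_scale)
      from low[OF this] show "m \<le> b (v - s n - t *\<^sub>R y) (v - s n - t *\<^sub>R y)"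
        by (simp add: diff_diff_add)
    qed
    also have "\<dots> \<le> inverse (real (Suc n)) * b y y"
      using s(2)[of n] by (intro mult_right_mono semi_inner_nonneg) simp
    finally show ?thesis by (metis real_sqrt_abs real_sqrt_le_mono real_sqrt_mult)
  qed
  moreover have "(\<lambda>n. sqrt (inverse (real (Suc n)))) \<longlonglongrightarrow> 0"
    using tendsto_real_sqrt[OF LIMSEQ_inverse_real_of_nat] by simp
  ultimately show ?thesis using s(1) unfolding asymptotic_projection_def by blast
qed

lemma asymptotic_projection_self: "v \<in> F \<Longrightarrow> asymptotic_projection F v (\<lambda>_. v)"
  unfolding asymptotic_projection_def
  using semi_inner_scale_left[of 0 0] by (auto intro!: exI[of _ "\<lambda>_. 0"])

lemma asymptotic_projection_add:
  assumes F: "subspace F" and "asymptotic_projection F v s" "asymptotic_projection F w t"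
  shows "asymptotic_projection F (v + w) (\<lambda>n. s n + t n)"
proof -
  from assms obtain \<epsilon> \<epsilon>' where e: "\<epsilon> \<longlonglongrightarrow> 0" "\<And>n y. y \<in> F \<Longrightarrow> \<bar>b (v - s n) y\<bar> \<le> \<epsilon> n * sqrt (b y y)"
    "\<epsilon>' \<longlonglongrightarrow> 0" "\<And>n y. y \<in> F \<Longrightarrow> \<bar>b (w - t n) y\<bar> \<le> \<epsilon>' n * sqrt (b y y)"
    and st: "\<And>n. s n \<in> F" "\<And>n. t n \<in> F"
    unfolding asymptotic_projection_def by metis
  have "\<bar>b (v + w - (s n + t n)) y\<bar> \<le> (\<epsilon> n + \<epsilon>' n) * sqrt (b y y)" if "y \<in> F" for n y
    using e(2)[OF that, of n] e(4)[OF that, of n] by (simp add: semi_inner_simps algebra_simps)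
  moreover have "(\<lambda>n. \<epsilon> n + \<epsilon>' n) \<longlonglongrightarrow> 0" using tendsto_add[OF e(1,3)] by simp
  ultimately show ?thesis
    using st F unfolding asymptotic_projection_def by (auto intro: subspace_add)
qed

lemma asymptotic_projection_scale:
  assumes F: "subspace F" and "asymptotic_projection F v s"
  shows "asymptotic_projection F (c *\<^sub>R v) (\<lambda>n. c *\<^sub>R s n)"
proof -
  from assms obtain \<epsilon> where e: "\<epsilon> \<longlonglongrightarrow> 0" "\<And>n y. y \<in> F \<Longrightarrow> \<bar>b (v - s n) y\<bar> \<le> \<epsilon> n * sqrt (b y y)"
    and s: "\<And>n. s n \<in> F"
    unfolding asymptotic_projection_def by metis
  have "\<bar>b (c *\<^sub>R v - c *\<^sub>R s n) y\<bar> \<le> (\<bar>c\<bar> * \<epsilon> n) * sqrt (b y y)" if "y \<in> F" for n y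
    using mult_left_mono[OF e(2)[OF that, of n], of "\<bar>c\<bar>"]
    by (simp add: semi_inner_simps abs_mult flip: right_diff_distrib)
  moreover have "(\<lambda>n. \<bar>c\<bar> * \<epsilon> n) \<longlonglongrightarrow> 0" using tendsto_mult_left[OF e(1), of "\<bar>c\<bar>"] by simp
  ultimately show ?thesis
    using s F unfolding asymptotic_projection_def by (auto intro: subspace_scale)
qed

text \<open>Both residuals are nearly orthogonal to \<open>y = s m - t n\<close>, which lies in
  \<open>F\<close>, so \<open>b y y\<close> is a difference of two small terms. For
  \<open>s = t\<close> this is the Cauchy property in the seminorm.\<close>

lemma asymptotic_projection_close:
  assumes F: "subspace F" and "asymptotic_projection F v s" "asymptotic_projection F v t"
  shows "\<exists>\<epsilon>. \<epsilon> \<longlonglongrightarrow> 0 \<and> (\<forall>m n. sqrt (b (s m - t n) (s m - t n)) \<le> \<epsilon> m + \<epsilon> n)"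
proof -
  from assms obtain \<epsilon> \<epsilon>' where e: "\<epsilon> \<longlonglongrightarrow> 0" "\<And>n y. y \<in> F \<Longrightarrow> \<bar>b (v - s n) y\<bar> \<le> \<epsilon> n * sqrt (b y y)"
    "\<epsilon>' \<longlonglongrightarrow> 0" "\<And>n y. y \<in> F \<Longrightarrow> \<bar>b (v - t n) y\<bar> \<le> \<epsilon>' n * sqrt (b y y)"
    and st: "\<And>n. s n \<in> F" "\<And>n. t n \<in> F"
    unfolding asymptotic_projection_def by metis
  \<comment> \<open>The given error sequences may be negative when the form vanishes on
    \<open>F\<close>; absolute values guard against that, and adding the two sequences gives a
    single one usable at both indices.\<close>
  have "sqrt (b (s m - t n) (s m - t n)) \<le> (\<bar>\<epsilon> m\<bar> + \<bar>\<epsilon>' m\<bar>) + (\<bar>\<epsilon> n\<bar> + \<bar>\<epsilon>' n\<bar>)" for m n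
  proof -
    define y where "y = s m - t n"
    define q where "q = sqrt (b y y)"
    have y: "y \<in> F" unfolding y_def using st F by (simp add: subspace_diff)
    have q0: "q \<ge> 0" unfolding q_def using semi_inner_nonneg by simp
    have "q * q = b (v - t n) y - b (v - s m) y"
      unfolding q_def using semi_inner_nonneg[of y] by (simp add: semi_inner_diff_left y_def)
    also have "\<dots> \<le> \<epsilon>' n * q + \<epsilon> m * q"
      using e(2)[OF y, of m] e(4)[OF y, of n] unfolding q_def by linarith
    also have "\<dots> = (\<epsilon>' n + \<epsilon> m) * q" by (simp add: algebra_simps)
    finally have "q * q \<le> (\<epsilon>' n + \<epsilon> m) * q" .
    then have "q \<le> \<bar>\<epsilon>' n\<bar> + \<bar>\<epsilon> m\<bar>"
      using q0 by (cases "q = 0") auto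
    then show ?thesis unfolding q_def y_def by linarith
  qed
  moreover have "(\<lambda>n. \<bar>\<epsilon> n\<bar> + \<bar>\<epsilon>' n\<bar>) \<longlonglongrightarrow> 0"
    using tendsto_add[OF tendsto_rabs[OF e(1)] tendsto_rabs[OF e(3)]] by simp
  ultimately show ?thesis by blast
qed

text \<open>Projections do not increase the seminorm: the residual is tested against
  \<open>s n\<close> itself.\<close>

lemma asymptotic_projection_le:
  assumes "asymptotic_projection F v s"
  shows "\<exists>\<epsilon>. \<epsilon> \<longlonglongrightarrow> 0 \<and> (\<forall>n. sqrt (b (s n) (s n)) \<le> sqrt (b v v) + \<epsilon> n)"
proof -
  from assms obtain \<epsilon> where e: "\<epsilon> \<longlonglongrightarrow> 0" "\<And>n y. y \<in> F \<Longrightarrow> \<bar>b (v - s n) y\<bar> \<le> \<epsilon> n * sqrt (b y y)"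
    and s: "\<And>n. s n \<in> F"
    unfolding asymptotic_projection_def by metis
  have "sqrt (b (s n) (s n)) \<le> sqrt (b v v) + \<bar>\<epsilon> n\<bar>" for n
  proof -
    define q where "q = sqrt (b (s n) (s n))"
    have q0: "q \<ge> 0" unfolding q_def using semi_inner_nonneg by simp
    have "q * q = b v (s n) - b (v - s n) (s n)"
      unfolding q_def using semi_inner_nonneg[of "s n"] by (simp add: semi_inner_diff_left)
    also have "\<dots> \<le> sqrt (b v v) * q + \<epsilon> n * q"
      using e(2)[OF s, of n n] semi_inner_Cauchy_Schwarz[of v "s n"] unfolding q_def by linarith
    finally have "q * q \<le> (sqrt (b v v) + \<epsilon> n) * q" by (simp add: algebra_simps)
    then have "q \<le> \<bar>sqrt (b v v) + \<epsilon> n\<bar>"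
      using q0 by (cases "q = 0") auto
    also have "\<dots> \<le> sqrt (b v v) + \<bar>\<epsilon> n\<bar>"
      using semi_inner_nonneg[of v] abs_triangle_ineq[of "sqrt (b v v)" "\<epsilon> n"] by simp
    finally show ?thesis unfolding q_def .
  qed
  moreover have "(\<lambda>n. \<bar>\<epsilon> n\<bar>) \<longlonglongrightarrow> 0" using tendsto_rabs[OF e(1)] by simp
  ultimately show ?thesis by blast
qed

section \<open>Extension along asymptotic projections\<close>

context
  fixes F :: "'v set" and f :: "'v \<Rightarrow> 'k::banach"
  assumes F: "subspace F" and f: "linear_on F f" and fb: "\<And>y. y \<in> F \<Longrightarrow> norm (f y) \<le> sqrt (b y y)"
begin

text \<open>\<open>f\<close> is Lipschitz for the seminorm, so sequences that approach each other
  have images with the same limit. Independence of the chosen sequence is what makes the limit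
  linear in \<open>v\<close>.\<close>

lemma asymptotic_projection_tendsto_unique:
  assumes s: "asymptotic_projection F v s" and t: "asymptotic_projection F v t"
    and "(\<lambda>n. f (s n)) \<longlonglongrightarrow> l"
  shows "(\<lambda>n. f (t n)) \<longlonglongrightarrow> l"
proof -
  obtain \<epsilon> where e: "\<epsilon> \<longlonglongrightarrow> 0" "\<And>m n. sqrt (b (t m - s n) (t m - s n)) \<le> \<epsilon> m + \<epsilon> n"
    using asymptotic_projection_close[OF F t s] by blast
  have "norm (f (t n) - f (s n)) \<le> \<epsilon> n + \<epsilon> n" for n
  proof -
    have "t n \<in> F" "s n \<in> F" using s t by (auto simp: asymptotic_projection_def)
    then show ?thesis
      using fb[of "t n - s n"] e(2)[of n n] F linear_on_diff[OF f F, of "t n" "s n"] by (simp add: subspace_diff)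
  qed
  moreover have "(\<lambda>n. \<epsilon> n + \<epsilon> n) \<longlonglongrightarrow> 0" using tendsto_add[OF e(1) e(1)] by simp
  ultimately have "(\<lambda>n. f (t n) - f (s n)) \<longlonglongrightarrow> 0"
    by (rule Lim_null_comparison[OF always_eventually[OF allI]])
  from tendsto_add[OF this assms(3)] show ?thesis by simp
qed

lemma asymptotic_projection_convergent:
  assumes s: "asymptotic_projection F v s"
  shows "convergent (\<lambda>n. f (s n))"
proof -
  obtain \<epsilon> where e: "\<epsilon> \<longlonglongrightarrow> 0" "\<And>m n. sqrt (b (s m - s n) (s m - s n)) \<le> \<epsilon> m + \<epsilon> n"
    using asymptotic_projection_close[OF F s s] by blast
  have le: "norm (f (s m) - f (s n)) \<le> \<epsilon> m + \<epsilon> n" for m n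
  proof -
    have "s m \<in> F" "s n \<in> F" using s by (auto simp: asymptotic_projection_def)
    then show ?thesis
      using fb[of "s m - s n"] e(2)[of m n] F linear_on_diff[OF f F, of "s m" "s n"] by (simp add: subspace_diff)
  qed
  have "Cauchy (\<lambda>n. f (s n))"
  proof (rule CauchyI)
    fix r :: real assume "r > 0"
    then obtain N where N: "\<And>n. n \<ge> N \<Longrightarrow> \<bar>\<epsilon> n\<bar> < r / 2"
      using LIMSEQ_D[OF e(1), of "r / 2"] by auto
    have "norm (f (s m) - f (s n)) < r" if "m \<ge> N" "n \<ge> N" for m n
      using le[of m n] N[OF that(1)] N[OF that(2)] by linarith
    then show "\<exists>N. \<forall>m\<ge>N. \<forall>n\<ge>N. norm (f (s m) - f (s n)) < r" by blast
  qed
  then show ?thesis by (rule Cauchy_convergent)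
qed

text \<open>\<open>g\<close> is \<open>f\<close> composed with the projection onto \<open>F\<close>,
  realized as a limit along \<open>s v\<close>. The limit relation stays in the conclusion because
  later arguments compute with extensions through it.\<close>

lemma semi_inner_extension:
  assumes s: "\<And>v. asymptotic_projection F v (s v)"
  shows "\<exists>g. linear g \<and> (\<forall>v. (\<lambda>n. f (s v n)) \<longlonglongrightarrow> g v) \<and> (\<forall>v\<in>F. g v = f v) \<and>
           (\<forall>v. norm (g v) \<le> sqrt (b v v))"
proof -
  obtain g where g: "\<And>v. (\<lambda>n. f (s v n)) \<longlonglongrightarrow> g v"
    using asymptotic_projection_convergent[OF s] unfolding convergent_def by metis
  have uniq: "l = g v" if "asymptotic_projection F v t" "(\<lambda>n. f (t n)) \<longlonglongrightarrow> l" for v t l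
    by (rule LIMSEQ_unique[OF that(2) asymptotic_projection_tendsto_unique[OF s that(1) g]])
  have sF: "s v n \<in> F" for v n using s by (auto simp: asymptotic_projection_def)
  have "linear g"
  proof (rule linearI)
    fix v w
    have "(\<lambda>n. f (s v n + s w n)) \<longlonglongrightarrow> g v + g w"
      using tendsto_add[OF g g, of v w] linear_onD(1)[OF f sF sF] by simp
    from uniq[OF asymptotic_projection_add[OF F s s] this] show "g (v + w) = g v + g w" ..
  next
    fix c v
    have "(\<lambda>n. f (c *\<^sub>R s v n)) \<longlonglongrightarrow> c *\<^sub>R g v"
      using tendsto_scaleR[OF tendsto_const g, of c v] linear_onD(2)[OF f sF] by simp
    from uniq[OF asymptotic_projection_scale[OF F s] this] show "g (c *\<^sub>R v) = c *\<^sub>R g v" ..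
  qed
  moreover have "g v = f v" if "v \<in> F" for v
    using uniq[OF asymptotic_projection_self[OF that] tendsto_const] ..
  moreover have "norm (g v) \<le> sqrt (b v v)" for v
  proof -
    obtain \<epsilon> where e: "\<epsilon> \<longlonglongrightarrow> 0" "\<And>n. sqrt (b (s v n) (s v n)) \<le> sqrt (b v v) + \<epsilon> n"
      using asymptotic_projection_le[OF s[of v]] by blast
    have "(\<lambda>n. sqrt (b v v) + \<epsilon> n) \<longlonglongrightarrow> sqrt (b v v)" using tendsto_add[OF tendsto_const e(1)] by simp
    then show ?thesis
    proof (rule LIMSEQ_le[OF tendsto_norm[OF g]])
      show "\<exists>N. \<forall>n\<ge>N. norm (f (s v n)) \<le> sqrt (b v v) + \<epsilon> n"
        using fb[OF sF] e(2) by (meson order_trans)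
    qed
  qed
  ultimately show ?thesis using g by blast
qed

end

end

section \<open>Hilbert space cases: bounded extension and orthogonal projection\<close>

lemma semi_inner_inner: "c \<ge> 0 \<Longrightarrow> semi_inner (\<lambda>x y. c * inner x y)"
  by (auto simp: semi_inner_def inner_commute intro!: linearI simp: inner_simps algebra_simps)

text \<open>For the form \<open>C\<^sup>2 * inner x y\<close>, domination is the norm bound with
  constant \<open>C\<close>, so the extension keeps that constant.\<close>

lemma bounded_extension:
  fixes f :: "'v::real_inner \<Rightarrow> 'k::banach"
  assumes F: "subspace F" and f: "linear_on F f" and C: "0 \<le> C"
    and fb: "\<And>y. y \<in> F \<Longrightarrow> norm (f y) \<le> C * norm y"
  shows "\<exists>g. linear g \<and> (\<forall>v\<in>F. g v = f v) \<and> (\<forall>v. norm (g v) \<le> C * norm v)"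
proof -
  define b where "b = (\<lambda>x y::'v. C\<^sup>2 * inner x y)"
  have b: "semi_inner b" unfolding b_def by (rule semi_inner_inner) simp
  have sq: "sqrt (b y y) = C * norm y" for y
    using C by (simp add: b_def real_sqrt_mult norm_eq_sqrt_inner)
  obtain s where s: "\<And>v. asymptotic_projection b F v (s v)"
    using asymptotic_projection_exists[OF b F] by metis
  show ?thesis
    using semi_inner_extension[OF b F f _ s] fb unfolding sq by blast
qed

text \<open>Applied to the identity on \<open>M\<close>, the extension argument shows that
  asymptotic projections converge. Closedness keeps the limit in \<open>M\<close>, and the residual
  estimate passes to it.\<close>

lemma orthogonal_projection_exists:
  fixes M :: "'v::{real_inner,banach} set"
  assumes M: "subspace M" "closed M"
  shows "\<exists>y\<in>M. \<forall>z\<in>M. inner (x - y) z = 0"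
proof -
  define b where "b = (\<lambda>x y::'v. 1 * inner x y)"
  have b: "semi_inner b" unfolding b_def by (rule semi_inner_inner) simp
  obtain s where s: "\<And>v. asymptotic_projection b M v (s v)"
    using asymptotic_projection_exists[OF b M(1)] by metis
  obtain g where g: "(\<lambda>n. s x n) \<longlonglongrightarrow> g"
    using semi_inner_extension[OF b M(1), of "\<lambda>x. x" s] s
    by (auto simp: linear_on_def b_def norm_eq_sqrt_inner)
  from s[of x] obtain \<epsilon> where e: "\<epsilon> \<longlonglongrightarrow> 0" "\<And>n y. y \<in> M \<Longrightarrow> \<bar>b (x - s x n) y\<bar> \<le> \<epsilon> n * sqrt (b y y)"
    and sM: "\<And>n. s x n \<in> M"
    unfolding asymptotic_projection_def[OF b] by metis
  have "g \<in> M" using closed_sequentially[OF M(2) _ g] sM by blast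
  moreover have "inner (x - g) z = 0" if "z \<in> M" for z
  proof -
    have "(\<lambda>n. inner (x - s x n) z) \<longlonglongrightarrow> 0"
    proof (rule Lim_null_comparison)
      show "\<forall>\<^sub>F n in sequentially. norm (inner (x - s x n) z) \<le> \<epsilon> n * norm z"
        using e(2)[OF that] by (auto simp: b_def norm_eq_sqrt_inner)
      show "(\<lambda>n. \<epsilon> n * norm z) \<longlonglongrightarrow> 0" using tendsto_mult_right[OF e(1)] by simp
    qed
    moreover have "(\<lambda>n. inner (x - s x n) z) \<longlonglongrightarrow> inner (x - g) z"
      by (intro tendsto_intros g)
    ultimately show ?thesis using LIMSEQ_unique by blast
  qed
  ultimately show ?thesis by blast
qed

text \<open>
  On the product with the semi-inner product \<open>d \<oplus> e\<close>, the vectors \<open>(y, y)\<close> carry \<open>f\<close>; extending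
  \<open>f\<close> from this diagonal splits it into the two coordinate parts.
\<close>

lemma splitting_extension:
  fixes d e :: "'x::real_vector \<Rightarrow> 'x \<Rightarrow> real"
  assumes d: "semi_inner d" and e: "semi_inner e" and S: "subspace S"
  shows "\<exists>s. (\<forall>x n. s x n \<in> S) \<and>
    (\<forall>f :: 'x \<Rightarrow> 'k::banach. linear_on S f \<and> (\<forall>y\<in>S. (norm (f y))\<^sup>2 \<le> d y y + e y y) \<longrightarrow>
       (\<exists>g. linear g \<and> (\<forall>x. (\<lambda>n. f (s x n)) \<longlonglongrightarrow> g x) \<and> (\<forall>x. (norm (g x))\<^sup>2 \<le> d x x) \<and>
          (\<forall>y\<in>S. (norm (f y - g y))\<^sup>2 \<le> e y y)))"
proof -
  define b where "b = (\<lambda>u v. d (fst u) (fst v) + e (snd u) (snd v))"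
  define F where "F = (\<lambda>y. (y, y)) ` S"
  have b: "semi_inner b"
    using semi_inner_nonneg[OF d] semi_inner_nonneg[OF e]
    by (auto simp: semi_inner_def b_def semi_inner_sym[OF d] semi_inner_sym[OF e]
        semi_inner_simps[OF d] semi_inner_simps[OF e] algebra_simps intro!: linearI)
  have F: "subspace F"
    using S by (auto simp: subspace_def F_def zero_prod_def image_iff)
  obtain s where s: "\<And>v. asymptotic_projection b F v (s v)"
    using asymptotic_projection_exists[OF b F] by metis
  have sF: "s v n \<in> F" for v n using s unfolding asymptotic_projection_def[OF b] by blast
  \<comment> \<open>One sequence, the first coordinates of the projections of \<open>(x, 0)\<close>
    onto the diagonal, serves every \<open>f\<close>; the part \<open>g x\<close> is the extension
    at \<open>(x, 0)\<close>.\<close>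
  show ?thesis
  proof (intro exI[of _ "\<lambda>x n. fst (s (x, 0) n)"] conjI allI impI)
    fix x n show "fst (s (x, 0) n) \<in> S" using sF[of "(x, 0)" n] by (auto simp: F_def)
  next
    fix f :: "'x \<Rightarrow> 'k"
    assume f: "linear_on S f \<and> (\<forall>y\<in>S. (norm (f y))\<^sup>2 \<le> d y y + e y y)"
    have lin: "linear_on F (\<lambda>v. f (fst v))" using f by (auto simp: linear_on_def F_def)
    have "norm (f (fst v)) \<le> sqrt (b v v)" if "v \<in> F" for v
      using f that by (auto simp: F_def b_def intro!: real_le_rsqrt)
    from semi_inner_extension[OF b F lin this s] obtain h where h: "linear h"
      "\<And>v. (\<lambda>n. f (fst (s v n))) \<longlonglongrightarrow> h v" "\<And>v. v \<in> F \<Longrightarrow> h v = f (fst v)"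
      "\<And>v. norm (h v) \<le> sqrt (b v v)" by blast
    have hsq: "(norm (h v))\<^sup>2 \<le> b v v" for v
      using power_mono[OF h(4)[of v], of 2] semi_inner_nonneg[OF b, of v] by simp
    have "linear (\<lambda>x. h (x, 0))"
      using linear_add[OF h(1), of "(_, 0)" "(_, 0)"] linear_scale[OF h(1), of _ "(_, 0)"]
      by (auto intro!: linearI)
    moreover have "(norm (h (x, 0)))\<^sup>2 \<le> d x x" for x
      using hsq[of "(x, 0)"] semi_inner_scale_left[OF e, of 0 0 0] by (simp add: b_def)
    moreover have "(norm (f y - h (y, 0)))\<^sup>2 \<le> e y y" if "y \<in> S" for y
    proof -
      \<comment> \<open>\<open>(y, y) = (0, y) + (y, 0)\<close> lies on the diagonal, where the
        extension equals \<open>f\<close>; so the error is the value at \<open>(0, y)\<close>, a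
        vector that only \<open>e\<close> measures.\<close>
      have "h (0, y) = f y - h (y, 0)"
        using h(3)[of "(y, y)"] linear_add[OF h(1), of "(0, y)" "(y, 0)"] that by (simp add: F_def)
      then show ?thesis
        using hsq[of "(0, y)"] semi_inner_scale_left[OF d, of 0 0 0] by (simp add: b_def)
    qed
    ultimately show "\<exists>g. linear g \<and> (\<forall>x. (\<lambda>n. f (fst (s (x, 0) n))) \<longlonglongrightarrow> g x) \<and>
        (\<forall>x. (norm (g x))\<^sup>2 \<le> d x x) \<and> (\<forall>y\<in>S. (norm (f y - g y))\<^sup>2 \<le> e y y)"
      using h(2) by (intro exI[of _ "\<lambda>x. h (x, 0)"]) auto
  qed
qed

section \<open>The lifting iteration\<close>

text \<open>By Pythagoras the bound on the partial sums makes the squared norms summable; again by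
  Pythagoras, the tails of the series are then small.\<close>

lemma orthogonal_partial_sums_convergent:
  fixes D :: "nat \<Rightarrow> 'k::{real_inner,banach}"
  assumes orth: "\<And>j k. j < k \<Longrightarrow> inner (D j) (D k) = 0"
    and bound: "\<And>n. (norm (\<Sum>k<n. D k))\<^sup>2 \<le> C"
  shows "convergent (\<lambda>n. \<Sum>k<n. D k)"
proof -
  have pyth: "(norm (sum D A))\<^sup>2 = (\<Sum>k\<in>A. (norm (D k))\<^sup>2)" if "finite A" for A
  proof (rule norm_sum_Pythagorean[OF that])
    show "pairwise (\<lambda>i j. orthogonal (D i) (D j)) A"
      unfolding pairwise_def orthogonal_def using orth inner_commute by (metis neq_iff)
  qed
  have "summable (\<lambda>k. (norm (D k))\<^sup>2)"
    using bound by (intro summableI_nonneg_bounded[where x = C]) (auto simp: pyth)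
  have "summable D"
    unfolding summable_Cauchy
  proof (intro allI impI)
    fix r :: real assume r: "r > 0"
    obtain N where N: "\<And>m n. m \<ge> N \<Longrightarrow> norm (\<Sum>k=m..<n. (norm (D k))\<^sup>2) < r\<^sup>2"
      using \<open>summable (\<lambda>k. (norm (D k))\<^sup>2)\<close>[unfolded summable_Cauchy, rule_format, of "r\<^sup>2"] r
      by auto
    have "norm (sum D {m..<n}) < r" if "m \<ge> N" for m n
    proof -
      have "(norm (sum D {m..<n}))\<^sup>2 < r\<^sup>2"
        using N[OF that, of n] by (simp add: pyth)
      then show ?thesis using r by (simp add: power_less_imp_less_base)
    qed
    then show "\<exists>N. \<forall>m\<ge>N. \<forall>n. norm (sum D {m..<n}) < r" by blast
  qed
  then show ?thesis by (simp add: summable_iff_convergent)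
qed

text \<open>
  The increments of the iteration that replaces \<open>\<beta>\<close> by the splitting extension of \<open>f0 + L \<beta>\<close>
  are mutually orthogonal, which makes it converge pointwise.
\<close>

lemma lifting_iteration:
  fixes d e :: "'x::real_vector \<Rightarrow> 'x \<Rightarrow> real" and f0 :: "'x \<Rightarrow> 'k::{real_inner,banach}"
    and L :: "('x \<Rightarrow> 'k) \<Rightarrow> 'x \<Rightarrow> 'k" and N :: "'k set"
  assumes d: "semi_inner d" and e: "semi_inner e" and S: "subspace S"
    and N: "subspace N" "closed N"
    and f0: "linear_on S f0" "f0 ` S \<subseteq> N"
    and L_linear: "\<And>\<beta>. linear \<beta> \<Longrightarrow> linear_on S (L \<beta>)"
    and L_range: "\<And>\<beta>. linear \<beta> \<Longrightarrow> range \<beta> \<subseteq> N \<Longrightarrow> L \<beta> ` S \<subseteq> N"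
    and L_diff: "\<And>\<beta> \<beta>' y. linear \<beta> \<Longrightarrow> linear \<beta>' \<Longrightarrow> y \<in> S \<Longrightarrow> L (\<lambda>x. \<beta> x - \<beta>' x) y = L \<beta> y - L \<beta>' y"
    and L_orth: "\<And>\<beta> \<beta>' y y'. linear \<beta> \<Longrightarrow> linear \<beta>' \<Longrightarrow> (\<And>x x'. inner (\<beta> x) (\<beta>' x') = 0) \<Longrightarrow> y \<in> S \<Longrightarrow> y' \<in> S \<Longrightarrow>
        inner (L \<beta> y) (L \<beta>' y') = 0"
    and f0_L: "\<And>\<beta> y y'. linear \<beta> \<Longrightarrow> range \<beta> \<subseteq> N \<Longrightarrow> y \<in> S \<Longrightarrow> y' \<in> S \<Longrightarrow> inner (f0 y) (L \<beta> y') = 0"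
    and bound: "\<And>\<beta> y. linear \<beta> \<Longrightarrow> range \<beta> \<subseteq> N \<Longrightarrow> (\<And>x. (norm (\<beta> x))\<^sup>2 \<le> d x x) \<Longrightarrow> y \<in> S \<Longrightarrow>
        (norm (f0 y))\<^sup>2 + (norm (L \<beta> y))\<^sup>2 \<le> d y y + e y y"
    and L_tendsto: "\<And>\<beta> \<gamma> y. (\<And>x. (\<lambda>n. \<beta> n x) \<longlonglongrightarrow> \<gamma> x) \<Longrightarrow> y \<in> S \<Longrightarrow> (\<lambda>n. L (\<beta> n) y) \<longlonglongrightarrow> L \<gamma> y"
  shows "\<exists>\<beta>. linear \<beta> \<and> range \<beta> \<subseteq> N \<and> (\<forall>x. (norm (\<beta> x))\<^sup>2 \<le> d x x) \<and>
     (\<forall>y\<in>S. (norm (f0 y + L \<beta> y - \<beta> y))\<^sup>2 \<le> e y y)"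
proof -
  define good where "good = (\<lambda>\<beta>. linear \<beta> \<and> range \<beta> \<subseteq> N \<and> (\<forall>x. (norm (\<beta> x))\<^sup>2 \<le> d x x))"
  \<comment> \<open>\<open>s\<close> is fixed before the iteration starts, so consecutive iterates
    are limits along the same sequences and can be subtracted.\<close>
  obtain s where s: "\<And>x n. s x n \<in> S" and
    ext: "\<And>f :: 'x \<Rightarrow> 'k. linear_on S f \<Longrightarrow> (\<And>y. y \<in> S \<Longrightarrow> (norm (f y))\<^sup>2 \<le> d y y + e y y) \<Longrightarrow>
       \<exists>g. linear g \<and> (\<forall>x. (\<lambda>n. f (s x n)) \<longlonglongrightarrow> g x) \<and> (\<forall>x. (norm (g x))\<^sup>2 \<le> d x x) \<and>
          (\<forall>y\<in>S. (norm (f y - g y))\<^sup>2 \<le> e y y)"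
    using splitting_extension[OF d e S, where 'k = 'k] by metis
  have step: "\<exists>\<gamma>. good \<gamma> \<and> (\<forall>x. (\<lambda>n. f0 (s x n) + L \<beta> (s x n)) \<longlonglongrightarrow> \<gamma> x) \<and>
      (\<forall>y\<in>S. (norm (f0 y + L \<beta> y - \<gamma> y))\<^sup>2 \<le> e y y)" if "good \<beta>" for \<beta>
  proof -
    have \<beta>: "linear \<beta>" "range \<beta> \<subseteq> N" "\<And>x. (norm (\<beta> x))\<^sup>2 \<le> d x x" using that by (auto simp: good_def)
    have "linear_on S (\<lambda>y. f0 y + L \<beta> y)"
      by (intro linear_on_add f0 L_linear \<beta>)
    moreover have "(norm (f0 y + L \<beta> y))\<^sup>2 \<le> d y y + e y y" if "y \<in> S" for y
      using bound[OF \<beta> that] f0_L[OF \<beta>(1,2) that that]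
      by (simp add: norm_add_Pythagorean orthogonal_def)
    ultimately obtain \<gamma> where \<gamma>: "linear \<gamma>" "\<And>x. (\<lambda>n. f0 (s x n) + L \<beta> (s x n)) \<longlonglongrightarrow> \<gamma> x"
      "\<And>x. (norm (\<gamma> x))\<^sup>2 \<le> d x x" "\<And>y. y \<in> S \<Longrightarrow> (norm (f0 y + L \<beta> y - \<gamma> y))\<^sup>2 \<le> e y y"
      using ext[of "\<lambda>y. f0 y + L \<beta> y"] by blast
    have "f0 (s x n) + L \<beta> (s x n) \<in> N" for x n
      using f0(2) L_range[OF \<beta>(1,2)] s[of x n] by (auto intro!: subspace_add[OF N(1)])
    then have "range \<gamma> \<subseteq> N"
      using closed_sequentially[OF N(2) _ \<gamma>(2)] by blast
    with \<gamma> show ?thesis unfolding good_def by blast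
  qed
  have "(norm 0)\<^sup>2 \<le> d x x" for x using semi_inner_nonneg[OF d] by simp
  then have "good (\<lambda>_. 0)" using subspace_0[OF N(1)] by (auto simp: good_def linear_zero)
  define next_map where "next_map = (\<lambda>\<beta>. SOME \<gamma>. good \<gamma> \<and>
      (\<forall>x. (\<lambda>n. f0 (s x n) + L \<beta> (s x n)) \<longlonglongrightarrow> \<gamma> x) \<and>
      (\<forall>y\<in>S. (norm (f0 y + L \<beta> y - \<gamma> y))\<^sup>2 \<le> e y y))"
  have next_map: "good (next_map \<beta>) \<and>
      (\<forall>x. (\<lambda>n. f0 (s x n) + L \<beta> (s x n)) \<longlonglongrightarrow> next_map \<beta> x) \<and>
      (\<forall>y\<in>S. (norm (f0 y + L \<beta> y - next_map \<beta> y))\<^sup>2 \<le> e y y)" if "good \<beta>" for \<beta>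
    unfolding next_map_def by (rule someI_ex[OF step[OF that]])
  define B where "B = (\<lambda>n. (next_map ^^ n) (\<lambda>_. 0))"
  have B: "good (B n)" for n
  proof (induction n)
    case 0 then show ?case using \<open>good (\<lambda>_. 0)\<close> by (simp add: B_def)
  next
    case (Suc n) then show ?case using next_map[OF Suc] by (simp add: B_def)
  qed
  have B0: "B 0 = (\<lambda>_. 0)" and B_Suc: "B (Suc n) = next_map (B n)" for n
    by (simp_all add: B_def)
  have B_lim: "(\<lambda>m. f0 (s x m) + L (B n) (s x m)) \<longlonglongrightarrow> B (Suc n) x" for n x
    unfolding B_Suc using next_map[OF B[of n]] by blast
  have B_err: "(norm (f0 y + L (B n) y - B (Suc n) y))\<^sup>2 \<le> e y y" if "y \<in> S" for n y
    unfolding B_Suc using next_map[OF B[of n]] that by blast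
  have B_lin: "linear (B n)" and B_N: "range (B n) \<subseteq> N" and B_le: "(norm (B n x))\<^sup>2 \<le> d x x" for n x
    using B by (auto simp: good_def)
  define D where "D = (\<lambda>n x. B (Suc n) x - B n x)"
  have D_lin: "linear (D n)" for n unfolding D_def by (intro linear_compose_sub B_lin)
  have D_N: "range (D n) \<subseteq> N" for n unfolding D_def using B_N by (blast intro: subspace_diff[OF N(1)])
  have L0: "L (\<lambda>_. 0) y = 0" if "y \<in> S" for y
    using L_diff[OF linear_zero linear_zero that] by simp
  \<comment> \<open>Starting from \<open>0\<close>, the first increment comes from \<open>f0\<close>
    alone; each later one is the limit of \<open>L\<close> applied to the previous
    increment.\<close>
  have D_lim0: "(\<lambda>m. f0 (s x m)) \<longlonglongrightarrow> D 0 x" for x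
    using B_lim[of x 0] by (simp add: D_def B0 L0 s)
  have D_lim: "(\<lambda>m. L (D n) (s x m)) \<longlonglongrightarrow> D (Suc n) x" for n x
    using tendsto_diff[OF B_lim[of x "Suc n"] B_lim[of x n]]
    by (simp add: D_def L_diff[OF B_lin B_lin s])
  \<comment> \<open>Orthogonality propagates along the recursion: \<open>L\<close> preserves it, and
    the base case is the orthogonality of \<open>f0\<close> to the values of \<open>L\<close> on
    maps into \<open>N\<close>. Both survive the limits.\<close>
  have D_orth: "inner (D j x) (D k x') = 0" if "j < k" for j k x x'
    using that
  proof (induction j arbitrary: k x x')
    case 0
    then obtain k' where k: "k = Suc k'" by (cases k) auto
    have "(\<lambda>m. inner (f0 (s x m)) (L (D k') (s x' m))) \<longlonglongrightarrow> inner (D 0 x) (D k x')"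
      unfolding k by (intro tendsto_inner D_lim0 D_lim)
    then show ?case by (simp add: f0_L[OF D_lin D_N s s] LIMSEQ_const_iff)
  next
    case (Suc j)
    then obtain k' where k: "k = Suc k'" "j < k'" by (cases k) auto
    have "(\<lambda>m. inner (L (D j) (s x m)) (L (D k') (s x' m))) \<longlonglongrightarrow> inner (D (Suc j) x) (D k x')"
      unfolding k by (intro tendsto_inner D_lim)
    then show ?case by (simp add: L_orth[OF D_lin D_lin Suc.IH[OF k(2)] s s] LIMSEQ_const_iff)
  qed
  have B_sum: "(\<Sum>k<n. D k x) = B n x" for n x
    by (induction n) (simp_all add: B0 D_def)
  have "convergent (\<lambda>n. B n x)" for x
    using orthogonal_partial_sums_convergent[of "\<lambda>k. D k x" "d x x", OF D_orth] B_le
    by (simp add: B_sum)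
  then obtain \<beta> where \<beta>: "\<And>x. (\<lambda>n. B n x) \<longlonglongrightarrow> \<beta> x" unfolding convergent_def by metis
  have "linear \<beta>"
  proof (rule linearI)
    fix x y
    show "\<beta> (x + y) = \<beta> x + \<beta> y"
      using tendsto_add[OF \<beta> \<beta>, of x y] by (intro LIMSEQ_unique[OF \<beta>]) (simp add: linear_add[OF B_lin])
  next
    fix c x
    show "\<beta> (c *\<^sub>R x) = c *\<^sub>R \<beta> x"
      using tendsto_scaleR[OF tendsto_const \<beta>, of c x]
      by (intro LIMSEQ_unique[OF \<beta>]) (simp add: linear_scale[OF B_lin])
  qed
  moreover have "range \<beta> \<subseteq> N"
    using closed_sequentially[OF N(2) _ \<beta>] B_N by blast
  moreover have "(norm (\<beta> x))\<^sup>2 \<le> d x x" for x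
    by (rule LIMSEQ_le_const2[OF tendsto_power[OF tendsto_norm[OF \<beta>]]]) (use B_le in blast)
  \<comment> \<open>The estimate links stage \<open>n\<close> with stage \<open>Suc n\<close>; both
    converge to \<open>\<beta>\<close>, which is thus an approximate fixed point.\<close>
  moreover have "(norm (f0 y + L \<beta> y - \<beta> y))\<^sup>2 \<le> e y y" if "y \<in> S" for y
  proof (rule LIMSEQ_le_const2)
    show "(\<lambda>n. (norm (f0 y + L (B n) y - B (Suc n) y))\<^sup>2) \<longlonglongrightarrow> (norm (f0 y + L \<beta> y - \<beta> y))\<^sup>2"
      by (intro tendsto_intros L_tendsto \<beta> that LIMSEQ_Suc)
    show "\<exists>N. \<forall>n\<ge>N. (norm (f0 y + L (B n) y - B (Suc n) y))\<^sup>2 \<le> e y y"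
      using B_err[OF that] by blast
  qed
  ultimately show ?thesis by blast
qed

section \<open>Uniqueness and linearity of orthogonal projections\<close>

lemma orthogonal_projection_unique:
  fixes M :: "'v::real_inner set"
  assumes "subspace M" "y \<in> M" "\<And>z. z \<in> M \<Longrightarrow> inner (x - y) z = 0"
    and "y' \<in> M" "\<And>z. z \<in> M \<Longrightarrow> inner (x - y') z = 0"
  shows "y = y'"
proof -
  have "inner (y - y') (y - y') = inner (x - y') (y - y') - inner (x - y) (y - y')"
    by (simp add: inner_diff_left)
  also have "\<dots> = 0" using assms by (simp add: subspace_diff)
  finally show ?thesis by simp
qed

lemma orthogonal_projection_linear:
  fixes M :: "'v::real_inner set"
  assumes M: "subspace M" and P: "\<And>x. P x \<in> M" "\<And>x z. z \<in> M \<Longrightarrow> inner (x - P x) z = 0"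
  shows "linear P"
proof (rule linearI)
  fix x y
  show "P (x + y) = P x + P y"
  proof (rule orthogonal_projection_unique[OF M P])
    show "P x + P y \<in> M" by (rule subspace_add[OF M P(1) P(1)])
    show "inner (x + y - (P x + P y)) z = 0" if "z \<in> M" for z
      using P(2)[OF that, of x] P(2)[OF that, of y] by (simp add: inner_simps)
  qed
next
  fix c x
  show "P (c *\<^sub>R x) = c *\<^sub>R P x"
  proof (rule orthogonal_projection_unique[OF M P])
    show "c *\<^sub>R P x \<in> M" by (rule subspace_scale[OF M P(1)])
    show "inner (c *\<^sub>R x - c *\<^sub>R P x) z = 0" if "z \<in> M" for z
      using P(2)[OF that, of x] by (simp flip: scaleR_diff_right)
  qed
qed

section \<open>Approximate lifting over the reals\<close>

text \<open>
  The first component \<open>g y = P (L A y) - A y\<close> of the error is forced; \<open>\<beta>\<close> is the component of the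
  lifting in the orthogonal complement of \<open>H\<close>. Since \<open>\<parallel>A y + g y\<parallel>\<^sup>2 - \<parallel>A y\<parallel>\<^sup>2 \<ge> \<parallel>g y\<parallel>\<^sup>2 - 2 \<delta> \<parallel>y\<parallel>\<^sup>2\<close>,
  the remaining error can be kept below \<open>e y y = 2 \<delta> \<parallel>y\<parallel>\<^sup>2 - \<parallel>g y\<parallel>\<^sup>2\<close>.
\<close>

lemma real_approximate_lifting:
  fixes H :: "'k::{real_inner,banach} set" and A :: "'x::{real_inner,banach} \<Rightarrow> 'k"
    and V T :: "'i \<Rightarrow> 'k \<Rightarrow> 'k" and Q r :: "'i \<Rightarrow> 'x \<Rightarrow> 'x"
  assumes H: "subspace H" and P: "\<And>x. P x \<in> H" "\<And>x h. h \<in> H \<Longrightarrow> inner (x - P x) h = 0"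
    and V: "\<And>i. i \<in> I \<Longrightarrow> linear (V i)"
      "\<And>i j x y. i \<in> I \<Longrightarrow> j \<in> I \<Longrightarrow> inner (V i x) (V j y) = (if i = j then inner x y else 0)"
    and PV: "\<And>i x. i \<in> I \<Longrightarrow> P (V i x) = T i (P x)"
    and A: "linear A" "\<And>x. A x \<in> H" "\<And>x. norm (A x) \<le> norm x"
    and Q: "\<And>i. i \<in> I \<Longrightarrow> linear (Q i)" "\<And>i x. i \<in> I \<Longrightarrow> Q i (Q i x) = Q i x"
      "\<And>i j x. i \<in> I \<Longrightarrow> j \<in> I \<Longrightarrow> i \<noteq> j \<Longrightarrow> Q i (Q j x) = 0"
      "\<And>i j x y. i \<in> I \<Longrightarrow> j \<in> I \<Longrightarrow> i \<noteq> j \<Longrightarrow> inner (Q i x) (Q j y) = 0"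
    and r: "\<And>i. i \<in> I \<Longrightarrow> linear (r i)" "\<And>i x. i \<in> I \<Longrightarrow> norm (r i x) \<le> norm (Q i x)"
    and \<delta>: "0 \<le> \<delta>" "\<delta> \<le> 2"
      "\<And>J y. finite J \<Longrightarrow> J \<subseteq> I \<Longrightarrow> y = (\<Sum>i\<in>J. Q i y) \<Longrightarrow>
         norm (\<Sum>i\<in>J. T i (A (r i y)) - A (Q i y)) \<le> \<delta> * norm y"
  shows "\<exists>B. linear B \<and> (\<forall>x. norm (B x) \<le> norm x) \<and> (\<forall>x. P (B x) = A x) \<and>
     (\<forall>i\<in>I. \<forall>x. Q i x = x \<longrightarrow> (norm (V i (B (r i x)) - B x))\<^sup>2 \<le> 2 * \<delta> * (norm x)\<^sup>2)"
proof -
  \<comment> \<open>\<open>S\<close> is the algebraic sum of the ranges of the \<open>Q i\<close>,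
    so every sum below is finite even when \<open>I\<close> is infinite; the extension lemmas then
    reach the whole space.\<close>
  define S where "S = {x. \<exists>J. finite J \<and> J \<subseteq> I \<and> x = (\<Sum>i\<in>J. Q i x)}"
  define supp where "supp = (\<lambda>x. {i\<in>I. Q i x \<noteq> 0})"
  \<comment> \<open>Approximate fixed points of \<open>L\<close> are sought: for linear
    \<open>c\<close> and \<open>y\<close> in the range of \<open>Q i\<close>, the vector
    \<open>L c y\<close> is \<open>V i (c (r i y))\<close>.\<close>
  define L where "L = (\<lambda>(c :: 'x \<Rightarrow> 'k) y. \<Sum>i\<in>supp y. V i (c (r i y)))"
  define N where "N = {k. \<forall>h\<in>H. inner k h = 0}"
  have P_lin: "linear P" by (rule orthogonal_projection_linear[OF H P])
  have P_eq: "P x = y" if "y \<in> H" "\<And>z. z \<in> H \<Longrightarrow> inner (x - y) z = 0" for x y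
    by (rule orthogonal_projection_unique[OF H P that])
  have supp_subset: "supp x \<subseteq> J" if J: "finite J" "J \<subseteq> I" "x = (\<Sum>i\<in>J. Q i x)" for x J
  proof
    fix i assume i: "i \<in> supp x"
    show "i \<in> J"
    proof (rule ccontr)
      assume "i \<notin> J"
      have iI: "i \<in> I" using i by (simp add: supp_def)
      have "Q i x = (\<Sum>j\<in>J. Q i (Q j x))"
        by (subst J(3)) (simp add: linear_sum[OF Q(1)[OF iI]])
      also have "\<dots> = 0" using J \<open>i \<notin> J\<close> iI by (intro sum.neutral ballI Q(3)) auto
      finally show False using i by (simp add: supp_def)
    qed
  qed
  have S_iff: "x \<in> S \<longleftrightarrow> finite (supp x) \<and> x = (\<Sum>i\<in>supp x. Q i x)" for x
  proof
    assume "x \<in> S"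
    then obtain J where J: "finite J" "J \<subseteq> I" "x = (\<Sum>i\<in>J. Q i x)" by (auto simp: S_def)
    have "(\<Sum>i\<in>supp x. Q i x) = (\<Sum>i\<in>J. Q i x)"
      using J supp_subset[OF J] by (intro sum.mono_neutral_left) (auto simp: supp_def)
    with J supp_subset[OF J] show "finite (supp x) \<and> x = (\<Sum>i\<in>supp x. Q i x)"
      by (auto intro: finite_subset)
  qed (auto simp: S_def supp_def)
  have S_self: "(\<Sum>i\<in>supp x. Q i x) = x" if "x \<in> S" for x
    using iffD1[OF S_iff that] by (rule conjunct2[THEN sym])
  have S_sum: "x = (\<Sum>i\<in>J. Q i x)" if "x \<in> S" "finite J" "J \<subseteq> I" "supp x \<subseteq> J" for x J
  proof -
    have "(\<Sum>i\<in>supp x. Q i x) = (\<Sum>i\<in>J. Q i x)"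
      using that by (intro sum.mono_neutral_left) (auto simp: supp_def)
    then show ?thesis by (simp only: S_self[OF that(1)])
  qed
  have r0: "r i y = 0" if "i \<in> I" "Q i y = 0" for i y using r(2)[OF that(1), of y] that(2) by simp
  \<comment> \<open>Any finite index set containing the support gives the same value, so two vectors
    can be treated over a common index set.\<close>
  have L_eq: "L c y = (\<Sum>i\<in>J. V i (c (r i y)))"
    if "linear c" "finite J" "J \<subseteq> I" "supp y \<subseteq> J" for c y J
    unfolding L_def using that linear_0[OF V(1)] linear_0[OF that(1)] r0
    by (intro sum.mono_neutral_left) (auto simp: supp_def)
  have S: "subspace S"
  proof (rule subspaceI)
    show "0 \<in> S" unfolding S_def by (intro CollectI exI[of _ "{}"]) simp
  next
    fix x y assume xy: "x \<in> S" "y \<in> S"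
    let ?J = "supp x \<union> supp y"
    have J: "finite ?J" "?J \<subseteq> I" using xy S_iff by (auto simp: supp_def)
    have "x + y = (\<Sum>i\<in>?J. Q i x) + (\<Sum>i\<in>?J. Q i y)"
      using S_sum[OF xy(1) J] S_sum[OF xy(2) J] by simp
    also have "\<dots> = (\<Sum>i\<in>?J. Q i (x + y))"
      unfolding sum.distrib[symmetric] using J(2) Q(1) by (intro sum.cong refl) (auto simp: linear_add)
    finally show "x + y \<in> S" using J unfolding S_def by blast
  next
    fix c x assume x: "x \<in> S"
    have J: "finite (supp x)" "supp x \<subseteq> I" using x S_iff by (auto simp: supp_def)
    have "c *\<^sub>R x = c *\<^sub>R (\<Sum>i\<in>supp x. Q i x)" by (simp only: S_self[OF x])
    also have "\<dots> = (\<Sum>i\<in>supp x. Q i (c *\<^sub>R x))"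
      unfolding scaleR_sum_right using J(2) Q(1) by (intro sum.cong refl) (auto simp: linear_scale)
    finally show "c *\<^sub>R x \<in> S" using J unfolding S_def by blast
  qed
  have supp_fin: "finite (supp x)" "supp x \<subseteq> I" if "x \<in> S" for x
    using that S_iff by (auto simp: supp_def)
  have L_linear: "linear_on S (L c)" if c: "linear c" for c
  proof -
    have "L c (x + y) = L c x + L c y" if xy: "x \<in> S" "y \<in> S" for x y
    proof -
      let ?J = "supp x \<union> supp y"
      have J: "finite ?J" "?J \<subseteq> I" using xy supp_fin by auto
      have "supp (x + y) \<subseteq> ?J" by (auto simp: supp_def linear_add[OF Q(1)])
      then have "L c (x + y) = (\<Sum>i\<in>?J. V i (c (r i (x + y))))"
        using J c by (intro L_eq)
      also have "\<dots> = (\<Sum>i\<in>?J. V i (c (r i x)) + V i (c (r i y)))"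
      proof (intro sum.cong refl)
        fix i assume "i \<in> ?J"
        then have i: "i \<in> I" using J by blast
        show "V i (c (r i (x + y))) = V i (c (r i x)) + V i (c (r i y))"
          by (simp add: linear_add[OF r(1)[OF i]] linear_add[OF c] linear_add[OF V(1)[OF i]])
      qed
      also have "\<dots> = L c x + L c y"
        by (simp only: sum.distrib L_eq[OF c J Un_upper1] L_eq[OF c J Un_upper2])
      finally show ?thesis .
    qed
    moreover have "L c (a *\<^sub>R x) = a *\<^sub>R L c x" if x: "x \<in> S" for a x
    proof -
      have "supp (a *\<^sub>R x) \<subseteq> supp x" by (auto simp: supp_def linear_scale[OF Q(1)])
      then have "L c (a *\<^sub>R x) = (\<Sum>i\<in>supp x. V i (c (r i (a *\<^sub>R x))))"
        using supp_fin[OF x] c by (intro L_eq)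
      also have "\<dots> = (\<Sum>i\<in>supp x. a *\<^sub>R V i (c (r i x)))"
      proof (intro sum.cong refl)
        fix i assume "i \<in> supp x"
        then have i: "i \<in> I" using supp_fin[OF x] by blast
        show "V i (c (r i (a *\<^sub>R x))) = a *\<^sub>R V i (c (r i x))"
          by (simp add: linear_scale[OF r(1)[OF i]] linear_scale[OF c] linear_scale[OF V(1)[OF i]])
      qed
      finally show ?thesis by (simp add: scaleR_sum_right L_def)
    qed
    ultimately show ?thesis by (simp add: linear_on_def)
  qed
  \<comment> \<open>The orthogonal ranges of the isometries remove the cross terms; hence
    \<open>L\<close> carries maps with orthogonal ranges to maps with orthogonal ranges.\<close>
  have L_inner: "inner (L c y) (L c' y') = (\<Sum>i\<in>J. inner (c (r i y)) (c' (r i y')))"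
    if "linear c" "linear c'" and J: "finite J" "J \<subseteq> I" "supp y \<subseteq> J" "supp y' \<subseteq> J" for c c' y y' J
  proof -
    have "inner (L c y) (L c' y') =
        (\<Sum>i\<in>J. \<Sum>j\<in>J. inner (V j (c (r j y))) (V i (c' (r i y'))))"
      by (simp only: L_eq[OF that(1) J(1,2,3)] L_eq[OF that(2) J(1,2,4)] inner_sum_left inner_sum_right)
    also have "\<dots> = (\<Sum>i\<in>J. \<Sum>j\<in>J. if i = j then inner (c (r i y)) (c' (r i y')) else 0)"
      using J(2) by (intro sum.cong refl) (auto simp: V(2) subset_iff)
    also have "\<dots> = (\<Sum>i\<in>J. inner (c (r i y)) (c' (r i y')))"
      using J(1) by simp
    finally show ?thesis .
  qed
  have L_inner': "inner (L c y) (L c' y') = (\<Sum>i\<in>supp y \<union> supp y'. inner (c (r i y)) (c' (r i y')))"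
    if "linear c" "linear c'" "y \<in> S" "y' \<in> S" for c c' y y'
    using that supp_fin[of y] supp_fin[of y'] by (intro L_inner) auto
  have L_norm: "(norm (L c y))\<^sup>2 = (\<Sum>i\<in>supp y. (norm (c (r i y)))\<^sup>2)"
    if "linear c" "y \<in> S" for c y
    using L_inner'[OF that(1) that(1) that(2) that(2)] by (simp add: power2_norm_eq_inner)
  have N: "subspace N" "closed N"
  proof -
    show "subspace N" unfolding N_def by (auto intro!: subspaceI simp: inner_simps)
    have "N = (\<Inter>h\<in>H. {k. inner k h = 0})" by (auto simp: N_def)
    moreover have "closed {k. inner k h = 0}" for h
      by (intro closed_Collect_eq continuous_intros)
    ultimately show "closed N" by auto
  qed
  have P_diff_N: "k - P k \<in> N" for k using P(2) by (auto simp: N_def)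
  have N_iff: "k \<in> N \<longleftrightarrow> P k = 0" for k
    using P_diff_N[of k] P_eq[of 0 k] subspace_0[OF H] by (auto simp: N_def)
  have V_N: "V i k \<in> N" if "i \<in> I" "k \<in> N" for i k
  proof -
    \<comment> \<open>That \<open>T i\<close> sends \<open>0\<close> to \<open>0\<close> is read off
      from the lifting relation at \<open>0\<close>, where \<open>V i\<close> and \<open>P\<close>
      are linear.\<close>
    have "P (V i k) = T i (P 0)" using PV[OF that(1), of k] that(2) linear_0[OF P_lin] by (simp add: N_iff)
    also have "\<dots> = P (V i 0)" using PV[OF that(1), of 0] by simp
    also have "\<dots> = 0" using linear_0[OF P_lin] linear_0[OF V(1)[OF that(1)]] by simp
    finally show ?thesis by (simp add: N_iff)
  qed
  have HN: "inner h k = 0" if "h \<in> H" "k \<in> N" for h k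
    using that inner_commute[of h k] by (auto simp: N_def)
  have norm_split: "(norm (h + k))\<^sup>2 = (norm h)\<^sup>2 + (norm k)\<^sup>2" if "h \<in> H" "k \<in> N" for h k
    using HN[OF that] by (simp add: norm_add_Pythagorean orthogonal_def)

  define E where "E = (\<lambda>y. P (L A y) - A y)"
  have E_lin: "linear_on S E"
    using L_linear[OF A(1)]
    by (auto simp: linear_on_def E_def linear_add[OF P_lin] linear_scale[OF P_lin]
        linear_add[OF A(1)] linear_scale[OF A(1)] algebra_simps)
  have PA: "P (A x) = A x" for x by (rule P_eq[OF A(2)]) simp
  have "norm (E y) \<le> \<delta> * norm y" if y: "y \<in> S" for y
  proof -
    have "A y = A (\<Sum>i\<in>supp y. Q i y)" by (simp only: S_self[OF y])
    then have "A y = (\<Sum>i\<in>supp y. A (Q i y))" by (simp add: linear_sum[OF A(1)])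
    moreover have "P (L A y) = (\<Sum>i\<in>supp y. T i (A (r i y)))"
      unfolding L_def linear_sum[OF P_lin] by (intro sum.cong refl) (simp add: PV PA supp_def)
    ultimately have E: "E y = (\<Sum>i\<in>supp y. T i (A (r i y)) - A (Q i y))"
      by (simp add: E_def sum_subtractf)
    from \<delta>(3)[OF supp_fin[OF y] S_self[OF y, symmetric]] show ?thesis unfolding E .
  qed
  \<comment> \<open>The form \<open>e\<close> has to live on the whole space, so \<open>E\<close> is
    replaced by an extension with the same bound \<open>\<delta>\<close>.\<close>
  from bounded_extension[OF S E_lin \<delta>(1) this] obtain g where
    g: "linear g" "\<And>y. y \<in> S \<Longrightarrow> g y = E y" "\<And>y. norm (g y) \<le> \<delta> * norm y" by blast

  \<comment> \<open>\<open>d\<close> is the room left for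
    \<open>\<parallel>\<beta> x\<parallel>\<^sup>2\<close> under the contraction bound,
    \<open>e\<close> the room left in the error once \<open>g\<close> is counted, and
    \<open>f0\<close> the part of \<open>L A\<close> orthogonal to \<open>H\<close>.\<close>
  define d where "d = (\<lambda>x y. inner x y - inner (A x) (A y))"
  define e where "e = (\<lambda>x y. 2 * \<delta> * inner x y - inner (g x) (g y))"
  define f0 where "f0 = (\<lambda>y. L A y - P (L A y))"
  have d_sq: "d x x = (norm x)\<^sup>2 - (norm (A x))\<^sup>2" for x by (simp add: d_def power2_norm_eq_inner)
  have e_sq: "e x x = 2 * \<delta> * (norm x)\<^sup>2 - (norm (g x))\<^sup>2" for x by (simp add: e_def power2_norm_eq_inner)
  have d: "semi_inner d"
  proof -
    have "0 \<le> d x x" for x using A(3)[of x] by (simp add: d_sq power_mono)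
    then show ?thesis
      by (auto simp: semi_inner_def d_def inner_commute linear_add[OF A(1)] linear_scale[OF A(1)]
          inner_simps algebra_simps intro!: linearI)
  qed
  have e: "semi_inner e"
  proof -
    have "0 \<le> e x x" for x
    proof -
      have "(norm (g x))\<^sup>2 \<le> (\<delta> * norm x)\<^sup>2" using g(3) by (intro power_mono) auto
      also have "\<dots> = \<delta> * (\<delta> * (norm x)\<^sup>2)" by (simp add: power2_eq_square)
      \<comment> \<open>Here \<open>\<delta> \<le> 2\<close> enters:
        \<open>\<delta>\<^sup>2 \<le> 2 * \<delta>\<close> makes \<open>e\<close>
        nonnegative.\<close>
      also have "\<dots> \<le> 2 * (\<delta> * (norm x)\<^sup>2)" using \<delta> by (intro mult_right_mono) auto
      finally show ?thesis by (simp add: e_sq)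
    qed
    then show ?thesis
      by (auto simp: semi_inner_def e_def inner_commute linear_add[OF g(1)] linear_scale[OF g(1)]
          inner_simps algebra_simps intro!: linearI)
  qed
  have L_range: "L \<beta> y \<in> N" if "range \<beta> \<subseteq> N" for \<beta> y
    unfolding L_def using that by (intro subspace_sum[OF N(1)] V_N) (auto simp: supp_def)
  have PLA: "P (L A y) = A y + g y" if "y \<in> S" for y
    using g(2)[OF that] by (simp add: E_def)
  have "\<exists>\<beta>. linear \<beta> \<and> range \<beta> \<subseteq> N \<and> (\<forall>x. (norm (\<beta> x))\<^sup>2 \<le> d x x) \<and>
     (\<forall>y\<in>S. (norm (f0 y + L \<beta> y - \<beta> y))\<^sup>2 \<le> e y y)"
  proof (rule lifting_iteration[OF d e S N])
    show "linear_on S f0"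
      using L_linear[OF A(1)]
      by (auto simp: linear_on_def f0_def linear_add[OF P_lin] linear_scale[OF P_lin] algebra_simps)
    show "f0 ` S \<subseteq> N" using P_diff_N by (auto simp: f0_def)
  next
    fix \<beta> :: "'x \<Rightarrow> 'k" assume \<beta>: "linear \<beta>"
    show "linear_on S (L \<beta>)" by (rule L_linear[OF \<beta>])
    show "L \<beta> ` S \<subseteq> N" if "range \<beta> \<subseteq> N" using L_range[OF that] by blast
  next
    fix \<beta> \<beta>' :: "'x \<Rightarrow> 'k" and y assume "linear \<beta>" "linear \<beta>'" "y \<in> S"
    then show "L (\<lambda>x. \<beta> x - \<beta>' x) y = L \<beta> y - L \<beta>' y"
      unfolding L_def sum_subtractf[symmetric]
      by (intro sum.cong refl) (simp add: linear_diff[OF V(1)] supp_def)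
  next
    fix \<beta> \<beta>' :: "'x \<Rightarrow> 'k" and y y'
    assume "linear \<beta>" "linear \<beta>'" "\<And>x x'. inner (\<beta> x) (\<beta>' x') = 0" "y \<in> S" "y' \<in> S"
    then show "inner (L \<beta> y) (L \<beta>' y') = 0" by (simp add: L_inner')
  next
    fix \<beta> :: "'x \<Rightarrow> 'k" and y y' assume \<beta>: "linear \<beta>" "range \<beta> \<subseteq> N" "y \<in> S" "y' \<in> S"
    \<comment> \<open>\<open>A\<close> and \<open>\<beta>\<close> have orthogonal ranges, so
      \<open>L A\<close> and \<open>L \<beta>\<close> do too; passing to \<open>f0\<close> only
      removes a vector of \<open>H\<close>.\<close>
    have "inner (A x) (\<beta> x') = 0" for x x' using HN[OF A(2)] \<beta>(2) by blast
    then have "inner (L A y) (L \<beta> y') = 0" by (simp add: L_inner' A(1) \<beta>)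
    then show "inner (f0 y) (L \<beta> y') = 0"
      using HN[OF P(1) L_range[OF \<beta>(2)]] by (simp add: f0_def inner_diff_left)
  next
    fix \<beta> :: "'x \<Rightarrow> 'k" and y
    assume \<beta>: "linear \<beta>" "range \<beta> \<subseteq> N" "\<And>x. (norm (\<beta> x))\<^sup>2 \<le> d x x" and y: "y \<in> S"
    let ?J = "supp y"
    \<comment> \<open>Pythagoras for \<open>L A y\<close> yields \<open>f0\<close>, and the terms
      \<open>\<parallel>A (r i y)\<parallel>\<^sup>2\<close> cancel against those in the bound for
      \<open>L \<beta> y\<close>. What remains is at most \<open>\<parallel>y\<parallel>\<^sup>2 -
      \<parallel>A y + g y\<parallel>\<^sup>2\<close>, whose cross term costs at most
      \<open>2 * \<delta> * \<parallel>y\<parallel>\<^sup>2\<close>.\<close>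
    have "(norm (L A y))\<^sup>2 = (norm (P (L A y) + f0 y))\<^sup>2" by (simp add: f0_def)
    also have "\<dots> = (norm (A y + g y))\<^sup>2 + (norm (f0 y))\<^sup>2"
      using norm_split[OF P(1)[of "L A y"] P_diff_N[of "L A y"]] by (simp add: f0_def flip: PLA[OF y])
    finally have "(norm (f0 y))\<^sup>2 = (\<Sum>i\<in>?J. (norm (A (r i y)))\<^sup>2) - (norm (A y + g y))\<^sup>2"
      by (simp add: L_norm[OF A(1) y])
    moreover have "(norm (L \<beta> y))\<^sup>2 \<le> (\<Sum>i\<in>?J. (norm (r i y))\<^sup>2 - (norm (A (r i y)))\<^sup>2)"
      unfolding L_norm[OF \<beta>(1) y] using \<beta>(3) by (intro sum_mono) (simp add: d_sq)
    moreover have "(\<Sum>i\<in>?J. (norm (r i y))\<^sup>2) \<le> (\<Sum>i\<in>?J. (norm (Q i y))\<^sup>2)"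
      using supp_fin[OF y] r(2) by (intro sum_mono power_mono) auto
    moreover have "(\<Sum>i\<in>?J. (norm (Q i y))\<^sup>2) = (norm y)\<^sup>2"
    proof -
      have "pairwise (\<lambda>i j. orthogonal (Q i y) (Q j y)) ?J"
        unfolding pairwise_def orthogonal_def using supp_fin(2)[OF y] Q(4) by blast
      from norm_sum_Pythagorean[OF supp_fin(1)[OF y] this] show ?thesis by (simp only: S_self[OF y])
    qed
    moreover have "(norm (A y + g y))\<^sup>2 = (norm (A y))\<^sup>2 + 2 * inner (A y) (g y) + (norm (g y))\<^sup>2"
      by (simp add: power2_norm_eq_inner inner_simps inner_commute)
    moreover have "- inner (A y) (g y) \<le> \<delta> * (norm y)\<^sup>2"
    proof -
      have "- inner (A y) (g y) \<le> norm (A y) * norm (g y)"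
        using Cauchy_Schwarz_ineq2[of "A y" "g y"] by linarith
      also have "\<dots> \<le> norm y * (\<delta> * norm y)" using A(3) g(3) by (intro mult_mono) auto
      finally show ?thesis by (simp add: power2_eq_square mult_ac)
    qed
    ultimately show "(norm (f0 y))\<^sup>2 + (norm (L \<beta> y))\<^sup>2 \<le> d y y + e y y"
      unfolding d_sq e_sq sum_subtractf mult.assoc by linarith
  next
    fix \<beta> :: "nat \<Rightarrow> 'x \<Rightarrow> 'k" and \<gamma> y
    assume lim: "\<And>x. (\<lambda>n. \<beta> n x) \<longlonglongrightarrow> \<gamma> x" and y: "y \<in> S"
    show "(\<lambda>n. L (\<beta> n) y) \<longlonglongrightarrow> L \<gamma> y"
      unfolding L_def
    proof (rule tendsto_sum)
      fix i assume "i \<in> supp y"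
      then have i: "i \<in> I" by (simp add: supp_def)
      have "norm (V i x) = norm x" for x
        unfolding norm_eq_sqrt_inner V(2)[OF i i] by simp
      then have "bounded_linear (V i)"
        using linear_add[OF V(1)[OF i]] linear_scale[OF V(1)[OF i]]
        by (intro bounded_linear_intro[where K = 1]) auto
      then show "(\<lambda>n. V i (\<beta> n (r i y))) \<longlonglongrightarrow> V i (\<gamma> (r i y))"
        by (rule bounded_linear.tendsto) (rule lim)
    qed
  qed
  then obtain \<beta> where \<beta>: "linear \<beta>" "range \<beta> \<subseteq> N" "\<And>x. (norm (\<beta> x))\<^sup>2 \<le> d x x"
    "\<And>y. y \<in> S \<Longrightarrow> (norm (f0 y + L \<beta> y - \<beta> y))\<^sup>2 \<le> e y y" by blast
  have \<beta>N: "\<beta> x \<in> N" for x using \<beta>(2) by blast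
  show ?thesis
  proof (intro exI[of _ "\<lambda>x. A x + \<beta> x"] conjI allI ballI impI)
    show "linear (\<lambda>x. A x + \<beta> x)" by (intro linear_compose_add A \<beta>)
  next
    fix x
    have "(norm (A x + \<beta> x))\<^sup>2 \<le> (norm x)\<^sup>2"
      using \<beta>(3)[of x] by (simp add: norm_split[OF A(2) \<beta>N] d_sq)
    then show "norm (A x + \<beta> x) \<le> norm x" by (rule power2_le_imp_le) simp
    show "P (A x + \<beta> x) = A x" using \<beta>N[of x] by (intro P_eq[OF A(2)]) (simp add: N_def)
  next
    fix i x assume i: "i \<in> I" and x: "Q i x = x"
    \<comment> \<open>A vector fixed by \<open>Q i\<close> has support inside \<open>{i}\<close>, so
      the single operator \<open>V i\<close> is recovered from \<open>L\<close>.\<close>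
    have J: "finite {i}" "{i} \<subseteq> I" "x = (\<Sum>i\<in>{i}. Q i x)" using i x by auto
    have xS: "x \<in> S" unfolding S_def using J by blast
    have "V i (A (r i x) + \<beta> (r i x)) - (A x + \<beta> x) = L A x + L \<beta> x - (A x + \<beta> x)"
      using L_eq[OF A(1) J(1,2) supp_subset[OF J]] L_eq[OF \<beta>(1) J(1,2) supp_subset[OF J]] i
      by (simp add: linear_add[OF V(1)])
    also have "\<dots> = g x + (f0 x + L \<beta> x - \<beta> x)"
      using PLA[OF xS] by (simp add: f0_def algebra_simps)
    finally have eq: "V i (A (r i x) + \<beta> (r i x)) - (A x + \<beta> x) = g x + (f0 x + L \<beta> x - \<beta> x)" .
    have "g x \<in> H" unfolding g(2)[OF xS] E_def by (rule subspace_diff[OF H P(1) A(2)])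
    moreover have "f0 x + L \<beta> x - \<beta> x \<in> N"
      unfolding f0_def
      by (rule subspace_diff[OF N(1) subspace_add[OF N(1) P_diff_N L_range[OF \<beta>(2)]] \<beta>N])
    ultimately show "(norm (V i (A (r i x) + \<beta> (r i x)) - (A x + \<beta> x)))\<^sup>2 \<le> 2 * \<delta> * (norm x)\<^sup>2"
      using \<beta>(4)[OF xS] unfolding eq by (simp add: norm_split e_sq)
  qed
qed

section \<open>Complex Hilbert spaces\<close>

text \<open>The representing vector is a multiple of the component \<open>w\<close> of some vector
  outside the kernel that is orthogonal to the kernel; subtracting
  \<open>(\<psi> z / \<psi> w) *\<^sub>R w\<close> moves any \<open>z\<close> into the
  kernel.\<close>

lemma real_Riesz:
  fixes \<psi> :: "'a::{real_inner,banach} \<Rightarrow> real"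
  assumes "bounded_linear \<psi>"
  shows "\<exists>x. \<forall>z. \<psi> z = inner z x"
proof (cases "\<forall>z. \<psi> z = 0")
  case True
  then show ?thesis by (intro exI[of _ 0]) simp
next
  case False
  then obtain w0 where w0: "\<psi> w0 \<noteq> 0" by blast
  interpret bounded_linear \<psi> by fact
  let ?K = "{z. \<psi> z = 0}"
  have "subspace ?K" by (auto intro!: subspaceI simp: add scale zero)
  moreover have "closed ?K"
    by (intro closed_Collect_eq continuous_on continuous_on_const continuous_on_id)
  ultimately obtain p where p: "\<psi> p = 0" "\<And>z. \<psi> z = 0 \<Longrightarrow> inner (w0 - p) z = 0"
    using orthogonal_projection_exists[of ?K w0] by auto
  define w where "w = w0 - p"
  have w: "\<psi> w \<noteq> 0" using w0 p(1) by (simp add: w_def diff)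
  then have "w \<noteq> 0" using zero by auto
  have "\<psi> z = inner z ((\<psi> w / inner w w) *\<^sub>R w)" for z
  proof -
    have "inner w (z - (\<psi> z / \<psi> w) *\<^sub>R w) = 0"
      using p(2)[of "z - (\<psi> z / \<psi> w) *\<^sub>R w"] w by (simp add: diff scale w_def[symmetric])
    then have "inner z w = (\<psi> z / \<psi> w) * inner w w"
      by (simp add: inner_diff_right inner_commute)
    then show ?thesis using w \<open>w \<noteq> 0\<close> by simp
  qed
  then show ?thesis by blast
qed

section \<open>The complex structure over the real inner product\<close>

lemma scaleC_zero_right: "scaleC a (0::'a::complex_hilbert_space) = 0"
  using scaleC_add_right[of a "0::'a" 0] by simp

lemma scaleC_scaleR: "scaleC a (r *\<^sub>R (x::'a::complex_hilbert_space)) = r *\<^sub>R scaleC a x"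
  by (simp add: scaleR_eq_scaleC scaleC_scaleC mult.commute)

lemma scaleC_minus_right: "scaleC a (- (x::'a::complex_hilbert_space)) = - scaleC a x"
  using scaleC_scaleR[of a "-1" x] by simp

lemma scaleC_diff_right: "scaleC a (x - (y::'a::complex_hilbert_space)) = scaleC a x - scaleC a y"
  using scaleC_add_right[of a x "- y"] by (simp add: scaleC_minus_right)

lemma scaleC_ii_ii: "scaleC \<i> (scaleC \<i> (x::'a::complex_hilbert_space)) = - x"
  using scaleR_eq_scaleC[of "-1" x] by (simp add: scaleC_scaleC)

lemma scaleC_eq_scaleR: "scaleC a (x::'a::complex_hilbert_space) = Re a *\<^sub>R x + Im a *\<^sub>R scaleC \<i> x"
proof -
  have "scaleC a x = scaleC (complex_of_real (Re a) + complex_of_real (Im a) * \<i>) x"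
    by (metis complex_eq mult.commute)
  then show ?thesis by (simp add: scaleC_add_left scaleR_eq_scaleC scaleC_scaleC)
qed

lemma cinner_scaleC_right: "cinner x (scaleC a (y::'a::complex_hilbert_space)) = cnj a * cinner x y"
  by (subst (1 2) cinner_commute) (simp add: cinner_scaleC_left)

text \<open>A factor \<open>\<i>\<close> in the second argument comes out as \<open>- \<i>\<close>,
  so the imaginary part is a real inner product as well. Complex identities thus reduce to real
  ones.\<close>

lemma cinner_eq_Complex: "cinner x (y::'a::complex_hilbert_space) = Complex (inner x y) (inner x (scaleC \<i> y))"
  by (simp add: complex_eq_iff inner_eq_Re_cinner cinner_scaleC_right)

lemma norm_scaleC: "norm (scaleC a (x::'a::complex_hilbert_space)) = cmod a * norm x"
proof -
  have "inner (scaleC a x) (scaleC a x) = Re (a * cnj a * cinner x x)"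
    by (simp add: inner_eq_Re_cinner cinner_scaleC_left cinner_scaleC_right mult_ac)
  also have "\<dots> = (cmod a)\<^sup>2 * inner x x"
    unfolding complex_norm_square[symmetric] by (simp add: inner_eq_Re_cinner del: of_real_power)
  finally show ?thesis by (simp add: norm_eq_sqrt_inner real_sqrt_mult)
qed

lemma closed_csubspace_scaleC: "closed_csubspace M \<Longrightarrow> (x::'a::complex_hilbert_space) \<in> M \<Longrightarrow> scaleC a x \<in> M"
  by (simp add: closed_csubspace_def)

lemma closed_csubspace_UNIV: "closed_csubspace (UNIV :: 'a::complex_hilbert_space set)"
  by (simp add: closed_csubspace_def)

lemma closed_csubspace_imp_subspace: "closed_csubspace (M :: 'a::complex_hilbert_space set) \<Longrightarrow> subspace M"
  by (auto simp: closed_csubspace_def scaleR_eq_scaleC intro!: subspaceI)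

text \<open>\<open>M\<close> contains \<open>scaleC \<i> z\<close> along with \<open>z\<close>,
  which supplies the imaginary part. Complex projections can therefore be taken from the real
  theory.\<close>

lemma cinner_zero_iff:
  assumes "closed_csubspace M"
  shows "(\<forall>z\<in>M. cinner (x::'a::complex_hilbert_space) z = 0) \<longleftrightarrow> (\<forall>z\<in>M. inner x z = 0)"
proof
  assume "\<forall>z\<in>M. inner x z = 0"
  then have "inner x z = 0 \<and> inner x (scaleC \<i> z) = 0" if "z \<in> M" for z
    using closed_csubspace_scaleC[OF assms that] that by blast
  then show "\<forall>z\<in>M. cinner x z = 0" by (simp add: cinner_eq_Complex complex_eq_iff)
qed (simp add: inner_eq_Re_cinner)

lemma ortho_proj_eqI:
  assumes M: "closed_csubspace M" and y: "(y::'a::complex_hilbert_space) \<in> M" "\<And>z. z \<in> M \<Longrightarrow> inner (x - y) z = 0"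
  shows "ortho_proj M x = y"
  unfolding ortho_proj_def cinner_zero_iff[OF M]
proof (rule the_equality)
  fix y' assume "y' \<in> M \<and> (\<forall>z\<in>M. inner (x - y') z = 0)"
  then show "y' = y"
    using y by (intro orthogonal_projection_unique[OF closed_csubspace_imp_subspace[OF M]]) auto
qed (use y in blast)

lemma ortho_proj:
  assumes M: "closed_csubspace M"
  shows "ortho_proj M (x::'a::complex_hilbert_space) \<in> M" "z \<in> M \<Longrightarrow> inner (x - ortho_proj M x) z = 0"
proof -
  have "closed M" using M by (simp add: closed_csubspace_def)
  then obtain y where "y \<in> M" "\<And>z. z \<in> M \<Longrightarrow> inner (x - y) z = 0"
    using orthogonal_projection_exists[OF closed_csubspace_imp_subspace[OF M]] by blast
  with ortho_proj_eqI[OF M this]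
  show "ortho_proj M x \<in> M" "z \<in> M \<Longrightarrow> inner (x - ortho_proj M x) z = 0" by auto
qed

lemma ortho_proj_self: "closed_csubspace M \<Longrightarrow> (x::'a::complex_hilbert_space) \<in> M \<Longrightarrow> ortho_proj M x = x"
  by (rule ortho_proj_eqI) auto

lemma ortho_proj_linear: "closed_csubspace M \<Longrightarrow> linear (ortho_proj (M :: 'a::complex_hilbert_space set))"
  by (rule orthogonal_projection_linear[OF closed_csubspace_imp_subspace ortho_proj])

lemma ortho_proj_scaleC:
  assumes M: "closed_csubspace M"
  shows "ortho_proj M (scaleC a (x::'a::complex_hilbert_space)) = scaleC a (ortho_proj M x)"
proof (rule ortho_proj_eqI[OF M closed_csubspace_scaleC[OF M ortho_proj(1)[OF M]]])
  fix z assume "z \<in> M"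
  then have "cinner (x - ortho_proj M x) z = 0"
    using cinner_zero_iff[OF M] ortho_proj(2)[OF M] by blast
  then show "inner (scaleC a x - scaleC a (ortho_proj M x)) z = 0"
    by (simp add: inner_eq_Re_cinner cinner_scaleC_left flip: scaleC_diff_right)
qed

lemma norm_ortho_proj_le:
  assumes M: "closed_csubspace M"
  shows "norm (ortho_proj M (x::'a::complex_hilbert_space)) \<le> norm x"
proof -
  have "(norm (ortho_proj M x + (x - ortho_proj M x)))\<^sup>2 =
      (norm (ortho_proj M x))\<^sup>2 + (norm (x - ortho_proj M x))\<^sup>2"
    by (rule norm_add_Pythagorean)
      (simp add: orthogonal_def inner_commute[of "ortho_proj M x"] ortho_proj[OF M])
  then show ?thesis by (simp add: power2_le_imp_le)
qed

section \<open>Bounded operators, adjoints and operator norms\<close>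

lemma bounded_op_scaleR:
  assumes "bounded_op M N f" "x \<in> M"
  shows "f (r *\<^sub>R x) = r *\<^sub>R f x"
  using assms by (simp add: bounded_op_def scaleR_eq_scaleC)

lemma bounded_op_UNIV_bounded_linear:
  assumes f: "bounded_op UNIV N f"
  shows "bounded_linear f"
proof -
  obtain b where "\<And>x. norm (f x) \<le> b * norm x" using f unfolding bounded_op_def by blast
  then show ?thesis
    using f bounded_op_scaleR[OF f]
    by (intro bounded_linear_intro[where K = b]) (auto simp: bounded_op_def mult.commute)
qed

text \<open>The description in \<open>adjoint_op\<close> is met by exactly one vector: real Riesz
  representation gives the real part of the identity and, at \<open>scaleC \<i> z\<close>, the
  imaginary part; the real parts alone force uniqueness.\<close>

lemma adjoint_op_UNIV:
  assumes f: "bounded_op UNIV N f"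
  shows "cinner (f z) y = cinner z (adjoint_op UNIV f y)"
proof -
  have "bounded_linear (\<lambda>z. inner (f z) y)"
    by (rule bounded_linear_compose[OF bounded_linear_inner_left bounded_op_UNIV_bounded_linear[OF f]])
  then obtain x where x: "\<And>z. inner (f z) y = inner z x" using real_Riesz by blast
  have "cinner (f z) y = cinner z x" for z
  proof (rule complex_eqI)
    show "Re (cinner (f z) y) = Re (cinner z x)" using x[of z] by (simp add: inner_eq_Re_cinner)
    have "f (scaleC \<i> z) = scaleC \<i> (f z)" using f by (simp add: bounded_op_def)
    then show "Im (cinner (f z) y) = Im (cinner z x)"
      using x[of "scaleC \<i> z"] by (simp add: inner_eq_Re_cinner cinner_scaleC_left)
  qed
  moreover have "x' = x" if "\<forall>z. cinner (f z) y = cinner z x'" for x'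
  proof -
    have "inner z x' = inner z x" for z
      using x[of z] that by (metis inner_eq_Re_cinner)
    then show ?thesis by (metis inner_diff_right inner_eq_zero_iff right_minus_eq)
  qed
  ultimately have "adjoint_op UNIV f y = x"
    unfolding adjoint_op_def by (intro the_equality) auto
  then show ?thesis using \<open>cinner (f z) y = cinner z x\<close> by simp
qed

lemma op_norm_le:
  assumes "0 \<in> M" "\<And>x. x \<in> M \<Longrightarrow> norm x \<le> 1 \<Longrightarrow> norm (f x) \<le> c"
  shows "op_norm M f \<le> c"
  unfolding op_norm_def using assms by (intro cSUP_least) auto

text \<open>\<open>c\<close> makes the set of norms bounded above, so that the real
  \<open>SUP\<close> is a genuine supremum.\<close>

lemma op_norm_upper:
  assumes "\<And>x. x \<in> M \<Longrightarrow> norm x \<le> 1 \<Longrightarrow> norm (f x) \<le> c" "x \<in> M" "norm x \<le> 1"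
  shows "norm (f x) \<le> op_norm M f"
  unfolding op_norm_def using assms by (intro cSUP_upper) (auto intro!: bdd_aboveI2[where M = c])

lemma contraction_op_norm_le:
  assumes M: "closed_csubspace M" and f: "contraction_op M N f" and x: "x \<in> M"
  shows "norm (f x) \<le> norm x"
proof (cases "x = 0")
  case True
  then show ?thesis using bounded_op_scaleR[of M N f 0 0] f x by (auto simp: contraction_op_def)
next
  case False
  have b: "bounded_op M N f" using f by (simp add: contraction_op_def)
  then obtain c where c: "\<And>x. x \<in> M \<Longrightarrow> norm (f x) \<le> c * norm x"
    unfolding bounded_op_def by blast
  have c1: "norm (f x) \<le> \<bar>c\<bar>" if "x \<in> M" "norm x \<le> 1" for x
    using c[OF that(1)] mult_right_mono[OF abs_ge_self[of c] norm_ge_zero[of x]]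
      mult_left_mono[OF that(2) abs_ge_zero[of c]] by linarith
  have "inverse (norm x) *\<^sub>R x \<in> M"
    using subspace_scale[OF closed_csubspace_imp_subspace[OF M] x] .
  then have "norm (f (inverse (norm x) *\<^sub>R x)) \<le> op_norm M f"
    using False by (intro op_norm_upper[where c = "\<bar>c\<bar>"] c1) auto
  also have "\<dots> \<le> 1" using f by (simp add: contraction_op_def)
  finally show ?thesis using False by (simp add: bounded_op_scaleR[OF b x] field_simps)
qed

lemma contraction_opI:
  assumes "\<And>x. x \<in> M \<Longrightarrow> f x \<in> N" "\<And>x y. x \<in> M \<Longrightarrow> y \<in> M \<Longrightarrow> f (x + y) = f x + f y"
    and "\<And>a x. x \<in> M \<Longrightarrow> f (scaleC a x) = scaleC a (f x)"
    and le: "\<And>x. x \<in> M \<Longrightarrow> norm (f x) \<le> norm x" and "0 \<in> M"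
  shows "contraction_op M N f"
proof -
  have "bounded_op M N f"
    unfolding bounded_op_def using assms by (auto intro!: exI[of _ 1])
  moreover have "op_norm M f \<le> 1"
    using le by (intro op_norm_le \<open>0 \<in> M\<close>) (meson order_trans)
  ultimately show ?thesis by (simp add: contraction_op_def)
qed

section \<open>Isometric liftings and row norms\<close>

lemma isometric_lifting_cinner:
  assumes "isometric_lifting I H T V" "i \<in> I" "j \<in> I"
  shows "cinner (V i x) (V j y) = (if i = j then cinner x y else 0)"
proof -
  have "cinner (V i x) (V j y) = cinner x (adjoint_op UNIV (V i) (V j y))"
    using assms by (intro adjoint_op_UNIV[where N = UNIV]) (simp add: isometric_lifting_def)
  also have "adjoint_op UNIV (V i) (V j y) = (if i = j then y else 0)"
    using assms by (simp add: isometric_lifting_def)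
  finally show ?thesis by (simp add: cinner_eq_Complex scaleC_zero_right complex_eq_iff)
qed

text \<open>\<open>C\<close> bounds the set under the \<open>SUP\<close> and the zero family makes
  it nonempty, so the supremum is genuine.\<close>

lemma row_norm_bounds:
  assumes bound: "\<And>x. x \<in> direct_sum I X \<Longrightarrow> direct_sum_norm I x \<le> 1 \<Longrightarrow> norm (row_op I M x) \<le> C"
    and X: "\<And>i. i \<in> I \<Longrightarrow> 0 \<in> X i"
  shows "0 \<le> row_norm I X M" "row_norm I X M \<le> C"
    and "x \<in> direct_sum I X \<Longrightarrow> direct_sum_norm I x \<le> 1 \<Longrightarrow> norm (row_op I M x) \<le> row_norm I X M"
proof -
  have upper: "norm (row_op I M x) \<le> row_norm I X M" if "x \<in> direct_sum I X" "direct_sum_norm I x \<le> 1" for x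
    unfolding row_norm_def using that bound
    by (intro cSUP_upper) (auto intro!: bdd_aboveI2[where M = C])
  have zero: "(\<lambda>_. 0) \<in> direct_sum I X" "direct_sum_norm I (\<lambda>_. 0) \<le> 1"
    using X by (auto simp: direct_sum_def direct_sum_norm_def)
  show "0 \<le> row_norm I X M" using upper[OF zero] norm_ge_zero order_trans by blast
  show "row_norm I X M \<le> C"
    unfolding row_norm_def using zero bound by (intro cSUP_least) auto
  show "x \<in> direct_sum I X \<Longrightarrow> direct_sum_norm I x \<le> 1 \<Longrightarrow> norm (row_op I M x) \<le> row_norm I X M"
    by (rule upper)
qed

lemma norm_infsum_le:
  fixes f :: "'i \<Rightarrow> 'b::real_normed_vector"
  assumes "0 \<le> C" "\<And>J. finite J \<Longrightarrow> J \<subseteq> I \<Longrightarrow> norm (sum f J) \<le> C"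
  shows "norm (infsum f I) \<le> C"
proof (cases "f summable_on I")
  case True
  then have "(sum f \<longlongrightarrow> infsum f I) (finite_subsets_at_top I)"
    using has_sum_infsum has_sum_def by blast
  from tendsto_norm[OF this] show ?thesis
    by (rule tendsto_upperbound)
      (auto intro!: eventually_finite_subsets_at_top_weakI assms(2))
next
  case False
  \<comment> \<open>Without summability \<open>infsum\<close> is \<open>0\<close> by default, and
    \<open>0 \<le> C\<close> covers this value.\<close>
  then show ?thesis using assms(1) by (simp add: infsum_not_exists)
qed

section \<open>The lifting theorem\<close>

text \<open>The data are brought into real form: subspaces become projections \<open>Q i\<close>,
  the partial operators \<open>R i\<close> become the total \<open>r i\<close>, and the row norm
  becomes a bound over finite sums. The real linear lifting obtained is then made complex
  linear.\<close>

lemma approximate_lifting: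
  fixes H :: "'k::complex_hilbert_space set" and X :: "nat \<Rightarrow> 'x::complex_hilbert_space set"
  assumes data: "lifting_data n H T V X R A"
  defines "I \<equiv> index_set n"
  defines "\<delta> \<equiv> row_norm I X (\<lambda>i x. T i (A (R i x)) - A x)"
  shows "\<exists>B. contraction_op UNIV UNIV B \<and> (\<forall>x. ortho_proj H (B x) = A x) \<and>
          (\<forall>i\<in>I. op_norm (X i) (\<lambda>x. V i (B (R i x)) - B x) \<le> sqrt 2 * sqrt \<delta>)"
proof -
  define P where "P = ortho_proj H"
  define Q where "Q = (\<lambda>i. ortho_proj (X i))"
  define r where "r = (\<lambda>i x. R i (Q i x))"
  have H: "closed_csubspace H" and X: "\<And>i. i \<in> I \<Longrightarrow> closed_csubspace (X i)"
    and lift: "isometric_lifting I H T V" and AH: "contraction_op UNIV H A"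
    and R: "\<And>i. i \<in> I \<Longrightarrow> contraction_op (X i) UNIV (R i)"
    and orth: "\<And>i j. i \<in> I \<Longrightarrow> j \<in> I \<Longrightarrow> i \<noteq> j \<Longrightarrow> orthogonal_spaces (X i) (X j)"
    using data unfolding lifting_data_def I_def by blast+
  have P: "linear P" "\<And>x. P x \<in> H" "\<And>x h. h \<in> H \<Longrightarrow> inner (x - P x) h = 0"
    "\<And>x. norm (P x) \<le> norm x" "\<And>x. x \<in> H \<Longrightarrow> P x = x"
    unfolding P_def by (fact ortho_proj_linear[OF H] ortho_proj[OF H] norm_ortho_proj_le[OF H] ortho_proj_self[OF H])+
  have PV: "P (V i x) = T i (P x)" if "i \<in> I" for i x
    using lift that by (simp add: isometric_lifting_def P_def)
  have V_op: "bounded_op UNIV UNIV (V i)" if "i \<in> I" for i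
    using lift that by (simp add: isometric_lifting_def)
  have V_lin: "linear (V i)" if "i \<in> I" for i
    using bounded_op_UNIV_bounded_linear[OF V_op[OF that]] by (rule bounded_linear.linear)
  have V_inner: "inner (V i x) (V j y) = (if i = j then inner x y else 0)" if "i \<in> I" "j \<in> I" for i j x y
    using isometric_lifting_cinner[OF lift that] by (simp add: inner_eq_Re_cinner)
  have V_scaleC: "V i (scaleC a x) = scaleC a (V i x)" if "i \<in> I" for i a x
    using V_op[OF that] by (simp add: bounded_op_def)
  have A_op: "bounded_op UNIV H A" using AH by (simp add: contraction_op_def)
  have A: "linear A" "\<And>x. A x \<in> H" "\<And>x. norm (A x) \<le> norm x" "\<And>a x. A (scaleC a x) = scaleC a (A x)"
    using bounded_linear.linear[OF bounded_op_UNIV_bounded_linear[OF A_op]] A_op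
      contraction_op_norm_le[OF closed_csubspace_UNIV AH]
    by (auto simp: bounded_op_def)
  have Q: "linear (Q i)" "Q i x \<in> X i" "x \<in> X i \<Longrightarrow> Q i x = x" if "i \<in> I" for i x
    unfolding Q_def by (fact ortho_proj_linear[OF X[OF that]] ortho_proj[OF X[OF that]] ortho_proj_self[OF X[OF that]])+
  have X_orth: "inner x y = 0" if "i \<in> I" "j \<in> I" "i \<noteq> j" "x \<in> X i" "y \<in> X j" for i j x y
    using orth[OF that(1-3)] that(4,5) by (simp add: orthogonal_spaces_def inner_eq_Re_cinner)
  have R_norm: "norm (R i x) \<le> norm x" if "i \<in> I" "x \<in> X i" for i x
    by (rule contraction_op_norm_le[OF X[OF that(1)] R[OF that(1)] that(2)])
  have R_op: "bounded_op (X i) UNIV (R i)" if "i \<in> I" for i using R[OF that] by (simp add: contraction_op_def)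
  have r_lin: "linear (r i)" if "i \<in> I" for i
  proof (rule linearI)
    show "r i (x + y) = r i x + r i y" for x y
      using R_op[OF that] Q(2)[OF that] by (simp add: r_def linear_add[OF Q(1)[OF that]] bounded_op_def)
    show "r i (c *\<^sub>R x) = c *\<^sub>R r i x" for c x
      using Q(2)[OF that] by (simp add: r_def linear_scale[OF Q(1)[OF that]] bounded_op_scaleR[OF R_op[OF that]])
  qed
  have r_norm: "norm (r i x) \<le> norm (Q i x)" if "i \<in> I" for i x
    unfolding r_def by (rule R_norm[OF that Q(2)[OF that]])
  have Q_orth: "Q i (Q j x) = 0" if "i \<in> I" "j \<in> I" "i \<noteq> j" for i j x
  proof -
    have "ortho_proj (X i) (Q j x) = 0"
    proof (rule ortho_proj_eqI[OF X[OF that(1)]])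
      show "0 \<in> X i" using X[OF that(1)] by (simp add: closed_csubspace_def)
      show "inner (Q j x - 0) z = 0" if "z \<in> X i" for z
        using X_orth[OF \<open>i \<in> I\<close> \<open>j \<in> I\<close> \<open>i \<noteq> j\<close> that Q(2)[OF \<open>j \<in> I\<close>]] by (simp add: inner_commute)
    qed
    then show ?thesis by (simp only: Q_def)
  qed

  have norm_sum_V: "(norm (\<Sum>i\<in>J. V i (k i)))\<^sup>2 = (\<Sum>i\<in>J. (norm (k i))\<^sup>2)" if "finite J" "J \<subseteq> I" for J k
  proof -
    have "(norm (\<Sum>i\<in>J. V i (k i)))\<^sup>2 = (\<Sum>i\<in>J. (norm (V i (k i)))\<^sup>2)"
      using that V_inner by (intro norm_sum_Pythagorean) (auto simp: pairwise_def orthogonal_def subset_iff)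
    also have "\<dots> = (\<Sum>i\<in>J. (norm (k i))\<^sup>2)"
      using that V_inner by (intro sum.cong refl) (auto simp: power2_norm_eq_inner)
    finally show ?thesis .
  qed
  have norm_sum_X: "(norm (\<Sum>i\<in>J. x i))\<^sup>2 = (\<Sum>i\<in>J. (norm (x i))\<^sup>2)"
    if "finite J" "J \<subseteq> I" "\<And>i. i \<in> J \<Longrightarrow> x i \<in> X i" for J x
  proof (rule norm_sum_Pythagorean[OF that(1)])
    show "pairwise (\<lambda>i j. orthogonal (x i) (x j)) J"
      unfolding pairwise_def orthogonal_def
    proof (intro ballI impI)
      fix i j assume "i \<in> J" "j \<in> J" "i \<noteq> j"
      with that(2,3) show "inner (x i) (x j) = 0" by (intro X_orth[of i j]) auto
    qed
  qed
  have row_le_2: "norm (row_op I (\<lambda>i x. T i (A (R i x)) - A x) x) \<le> 2"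
    if x: "x \<in> direct_sum I X" "direct_sum_norm I x \<le> 1" for x
    unfolding row_op_def
  proof (rule norm_infsum_le)
    fix J assume J: "finite J" "J \<subseteq> I"
    have xX: "x i \<in> X i" if "i \<in> I" for i using x(1) that by (simp add: direct_sum_def)
    have "(\<Sum>i\<in>J. (norm (x i))\<^sup>2) \<le> (\<Sum>\<^sub>\<infinity>i\<in>I. (norm (x i))\<^sup>2)"
      using x(1) J by (intro finite_sum_le_infsum) (auto simp: direct_sum_def)
    also have "\<dots> \<le> 1" using x(2) by (simp add: direct_sum_norm_def)
    finally have sq: "(\<Sum>i\<in>J. (norm (x i))\<^sup>2) \<le> 1" .
    \<comment> \<open>\<open>P\<close> fixes the values of \<open>A\<close>, so the lifting relation
      rewrites this half of the row through the \<open>V i\<close>, whose orthogonal ranges bound it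
      by \<open>1\<close>.\<close>
    have "(\<Sum>i\<in>J. T i (A (R i (x i)))) = P (\<Sum>i\<in>J. V i (A (R i (x i))))"
      unfolding linear_sum[OF P(1)] using J PV P(5)[OF A(2)] by (intro sum.cong refl) auto
    then have "norm (\<Sum>i\<in>J. T i (A (R i (x i)))) \<le> norm (\<Sum>i\<in>J. V i (A (R i (x i))))"
      using P(4) by metis
    also have "(norm (\<Sum>i\<in>J. V i (A (R i (x i)))))\<^sup>2 \<le> (\<Sum>i\<in>J. (norm (x i))\<^sup>2)"
      unfolding norm_sum_V[OF J] using J order_trans[OF A(3) R_norm] xX
      by (intro sum_mono power_mono) auto
    from order_trans[OF this sq] have "norm (\<Sum>i\<in>J. V i (A (R i (x i)))) \<le> 1"
      by (simp only: abs_square_le_1 abs_norm_cancel)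
    finally have 1: "norm (\<Sum>i\<in>J. T i (A (R i (x i)))) \<le> 1" .
    have "norm (\<Sum>i\<in>J. A (x i)) \<le> norm (\<Sum>i\<in>J. x i)"
      unfolding linear_sum[OF A(1), symmetric] by (rule A(3))
    also have "(norm (\<Sum>i\<in>J. x i))\<^sup>2 \<le> 1"
      using sq J(2) xX by (subst norm_sum_X[OF J]) auto
    then have "norm (\<Sum>i\<in>J. x i) \<le> 1" by (simp only: abs_square_le_1 abs_norm_cancel)
    finally show "norm (\<Sum>i\<in>J. T i (A (R i (x i))) - A (x i)) \<le> 2"
      using 1 norm_triangle_ineq4[of "\<Sum>i\<in>J. T i (A (R i (x i)))" "\<Sum>i\<in>J. A (x i)"]
      by (simp add: sum_subtractf)
  qed simp
  have X0: "0 \<in> X i" if "i \<in> I" for i using X[OF that] by (simp add: closed_csubspace_def)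
  have \<delta>: "0 \<le> \<delta>" "\<delta> \<le> 2"
    unfolding \<delta>_def by (rule row_norm_bounds[where C = 2]; fact row_le_2 X0)+
  have \<delta>_upper: "norm (row_op I (\<lambda>i x. T i (A (R i x)) - A x) x) \<le> \<delta>"
    if "x \<in> direct_sum I X" "direct_sum_norm I x \<le> 1" for x
    unfolding \<delta>_def by (rule row_norm_bounds(3)[where C = 2, OF _ _ that]) (fact row_le_2 X0)+

  have row_le: "norm (\<Sum>i\<in>J. T i (A (r i y)) - A (Q i y)) \<le> \<delta> * norm y"
    if J: "finite J" "J \<subseteq> I" and y: "y = (\<Sum>i\<in>J. Q i y)" for J y
  proof -
    \<comment> \<open>Homogeneity of \<open>D\<close> reduces the claim to a unit vector, where the
      row norm applies.\<close>
    define D where "D = (\<lambda>y. (\<Sum>i\<in>J. T i (A (r i y)) - A (Q i y)))"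
    have "D y = P (\<Sum>i\<in>J. V i (A (r i y))) - (\<Sum>i\<in>J. A (Q i y))" for y
      unfolding linear_sum[OF P(1)] D_def sum_subtractf
      using J PV P(5)[OF A(2)] by (intro arg_cong2[where f = minus] sum.cong refl) auto
    then have D_scale: "D (c *\<^sub>R y) = c *\<^sub>R D y" for c y
      using J by (simp add: linear_scale[OF r_lin] linear_scale[OF A(1)] linear_scale[OF V_lin]
          linear_scale[OF Q(1)] linear_scale[OF P(1)] subset_iff scaleR_sum_right[symmetric]
          scaleR_diff_right cong: sum.cong)
    show ?thesis
    proof (cases "y = 0")
      case True
      then show ?thesis using D_scale[of 0 0] by (simp add: D_def)
    next
      case False
      define z where "z = inverse (norm y) *\<^sub>R y"
      \<comment> \<open>The components of \<open>z\<close>, continued by zero outside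
        \<open>J\<close>, form a family in the direct sum; orthogonality of the \<open>X i\<close>
        gives it the norm of \<open>z\<close>, namely \<open>1\<close>.\<close>
      define x where "x = (\<lambda>i. if i \<in> J then Q i z else 0)"
      have z: "norm z = 1" using False by (simp add: z_def)
      have zsum: "z = (\<Sum>i\<in>J. Q i z)"
        using J by (subst z_def, subst y) (simp add: z_def linear_scale[OF Q(1)] subset_iff scaleR_sum_right cong: sum.cong)
      have infsum_J: "infsum f I = sum f J" if "\<And>i. i \<notin> J \<Longrightarrow> f i = 0" for f :: "nat \<Rightarrow> 'z::{topological_comm_monoid_add,t2_space}"
        using J that infsum_cong_neutral[of J I f f] by auto
      have "(\<lambda>i. (norm (x i))\<^sup>2) summable_on I"
        by (rule iffD1[OF summable_on_cong_neutral summable_on_finite[OF J(1)]])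
          (use J in \<open>auto simp: x_def\<close>)
      then have "x \<in> direct_sum I X"
        using J Q(2) X0 by (auto simp: direct_sum_def x_def)
      moreover have "direct_sum_norm I x \<le> 1"
      proof -
        have "(\<Sum>\<^sub>\<infinity>i\<in>I. (norm (x i))\<^sup>2) = (\<Sum>i\<in>J. (norm (Q i z))\<^sup>2)"
          by (subst infsum_J) (auto simp: x_def)
        also have "\<dots> = (norm (\<Sum>i\<in>J. Q i z))\<^sup>2"
          using J Q(2) by (intro norm_sum_X[symmetric]) auto
        finally show ?thesis using z by (simp add: direct_sum_norm_def flip: zsum)
      qed
      ultimately have "norm (row_op I (\<lambda>i x. T i (A (R i x)) - A x) x) \<le> \<delta>"
        by (rule \<delta>_upper)
      moreover have "row_op I (\<lambda>i x. T i (A (R i x)) - A x) x = D z"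
      proof -
        \<comment> \<open>Outside \<open>J\<close> the family is \<open>0\<close>, so the row
          entries must vanish at \<open>0\<close>; for \<open>T i\<close> this comes from the
          lifting relation.\<close>
        have "T i (A (R i 0)) - A 0 = 0" if "i \<in> I" for i
        proof -
          have "T i (A (R i 0)) = P (V i (A (r i 0)))"
            using PV[OF that, of "A (r i 0)"] P(5)[OF A(2)] linear_0[OF Q(1)[OF that]] by (simp add: r_def)
          then show ?thesis
            by (simp add: linear_0[OF r_lin[OF that]] linear_0[OF A(1)] linear_0[OF V_lin[OF that]] linear_0[OF P(1)])
        qed
        then have "row_op I (\<lambda>i x. T i (A (R i x)) - A x) x =
            infsum (\<lambda>i. if i \<in> J then T i (A (r i z)) - A (Q i z) else 0) I"
          unfolding row_op_def by (intro infsum_cong) (auto simp: x_def r_def)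
        also have "\<dots> = D z" by (subst infsum_J) (auto simp: D_def)
        finally show ?thesis .
      qed
      ultimately have "norm (D y) \<le> \<delta> * norm y"
        using False by (simp add: z_def D_scale field_simps)
      then show ?thesis by (simp only: D_def)
    qed
  qed

  obtain C where C: "linear C" "\<And>x. norm (C x) \<le> norm x" "\<And>x. P (C x) = A x"
    "\<And>i x. i \<in> I \<Longrightarrow> Q i x = x \<Longrightarrow> (norm (V i (C (r i x)) - C x))\<^sup>2 \<le> 2 * \<delta> * (norm x)\<^sup>2"
  proof -
    have "\<exists>B. linear B \<and> (\<forall>x. norm (B x) \<le> norm x) \<and> (\<forall>x. P (B x) = A x) \<and>
     (\<forall>i\<in>I. \<forall>x. Q i x = x \<longrightarrow> (norm (V i (B (r i x)) - B x))\<^sup>2 \<le> 2 * \<delta> * (norm x)\<^sup>2)"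
    proof (rule real_approximate_lifting[where Q = Q and r = r and T = T and H = H])
      show "Q i (Q i x) = Q i x" if "i \<in> I" for i x by (rule Q(3)[OF that Q(2)[OF that]])
      show "inner (Q i x) (Q j y) = 0" if "i \<in> I" "j \<in> I" "i \<noteq> j" for i j x y
        by (rule X_orth[OF that Q(2)[OF that(1)] Q(2)[OF that(2)]])
    qed (fact closed_csubspace_imp_subspace[OF H] P V_lin V_inner PV A Q(1) Q_orth r_lin r_norm row_le
        \<delta>)+
    with that show thesis by blast
  qed

  text \<open>Averaging \<open>C\<close> with \<open>x \<mapsto> - \<i> C (\<i> x)\<close> makes it complex linear and keeps all estimates.\<close>
  define B where "B = (\<lambda>x. (1/2) *\<^sub>R (C x - scaleC \<i> (C (scaleC \<i> x))))"
  have B_add: "B (x + y) = B x + B y" for x y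
    by (simp add: B_def scaleC_add_right linear_add[OF C(1)] algebra_simps)
  have B_scaleR: "B (c *\<^sub>R x) = c *\<^sub>R B x" for c x
    by (simp add: B_def scaleC_scaleR linear_scale[OF C(1)] algebra_simps)
  \<comment> \<open>Multiplication by \<open>\<i>\<close> exchanges the two summands of the average;
    with real linearity this yields complex linearity.\<close>
  have B_ii: "B (scaleC \<i> x) = scaleC \<i> (B x)" for x
    by (simp add: B_def scaleC_scaleR scaleC_ii_ii linear_neg[OF C(1)] scaleC_minus_right scaleC_diff_right add.commute)
  have B_scaleC: "B (scaleC a x) = scaleC a (B x)" for a x
    by (simp add: scaleC_eq_scaleR[of a] B_add B_scaleR B_ii)
  have avg: "norm ((1/2) *\<^sub>R (u - scaleC \<i> v)) \<le> c" if "norm u \<le> c" "norm v \<le> c" for u v :: 'k and c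
    using that norm_triangle_ineq4[of u "scaleC \<i> v"] by (simp add: norm_scaleC)
  have B_norm: "norm (B x) \<le> norm x" for x
    unfolding B_def using C(2)[of x] C(2)[of "scaleC \<i> x"] by (intro avg) (simp_all add: norm_scaleC)
  have B_contr: "contraction_op UNIV UNIV B"
    by (rule contraction_opI) (simp_all add: B_add B_scaleC B_norm)
  have PB: "P (B x) = A x" for x
  proof -
    have P_scaleC: "P (scaleC a y) = scaleC a (P y)" for a y
      unfolding P_def by (rule ortho_proj_scaleC[OF H])
    \<comment> \<open>\<open>A\<close> is already complex linear, so averaging leaves it
      unchanged.\<close>
    have "P (B x) = (1/2) *\<^sub>R (A x - scaleC \<i> (A (scaleC \<i> x)))"
      by (simp only: B_def linear_scale[OF P(1)] linear_diff[OF P(1)] P_scaleC C(3))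
    also have "\<dots> = A x"
      by (simp add: A(4) scaleC_ii_ii flip: scaleR_2)
    finally show ?thesis .
  qed
  have "op_norm (X i) (\<lambda>x. V i (B (R i x)) - B x) \<le> sqrt 2 * sqrt \<delta>" if i: "i \<in> I" for i
  proof (rule op_norm_le[OF X0[OF i]])
    fix x assume x: "x \<in> X i" "norm x \<le> 1"
    define G where "G = (\<lambda>x. V i (C (R i x)) - C x)"
    have G: "norm (G y) \<le> sqrt 2 * sqrt \<delta>" if y: "y \<in> X i" "norm y \<le> 1" for y
    proof -
      have "(norm (G y))\<^sup>2 \<le> 2 * \<delta> * (norm y)\<^sup>2"
        using C(4)[OF i Q(3)[OF i y(1)]] by (simp add: G_def r_def Q(3)[OF i y(1)])
      also have "\<dots> \<le> 2 * \<delta> * 1"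
        using \<delta>(1) y(2) by (intro mult_left_mono) (auto simp: power_le_one)
      finally show ?thesis by (simp add: real_le_rsqrt flip: real_sqrt_mult)
    qed
    have Ri: "R i (scaleC \<i> x) = scaleC \<i> (R i x)" using R_op[OF i] x(1) by (simp add: bounded_op_def)
    \<comment> \<open>\<open>V i\<close> and \<open>R i\<close> commute with \<open>\<i>\<close>, so
      the error of \<open>B\<close> is the same average of the errors of \<open>C\<close> at
      \<open>x\<close> and \<open>scaleC \<i> x\<close>.\<close>
    have "V i (B (R i x)) - B x = (1/2) *\<^sub>R (G x - scaleC \<i> (G (scaleC \<i> x)))"
      by (simp add: B_def G_def Ri linear_scale[OF V_lin[OF i]] linear_diff[OF V_lin[OF i]] V_scaleC[OF i]
          scaleC_diff_right algebra_simps)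
    then show "norm (V i (B (R i x)) - B x) \<le> sqrt 2 * sqrt \<delta>"
      using G[OF x] G[OF closed_csubspace_scaleC[OF X[OF i] x(1)], of \<i>] x(2) by (simp only:) (intro avg, auto simp: norm_scaleC)
  qed
  with B_contr PB show ?thesis unfolding P_def by blast
qed

section \<open>Sharpness of the constant\<close>

text \<open>For injective \<open>\<phi>\<close>, the isometry sending the basis vector with index
  \<open>k\<close> to the one with index \<open>\<phi> k\<close>.\<close>

definition ell2_spread :: "(nat \<Rightarrow> nat) \<Rightarrow> ell2 \<Rightarrow> ell2" where
  "ell2_spread \<phi> x = Abs_ell2 (\<lambda>m. if m \<in> range \<phi> then ell2_nth x (inv \<phi> m) else 0)"

lemma ell2_nth_spread_eq:
  assumes "strict_mono \<phi>"
  shows "ell2_nth (ell2_spread \<phi> x) = (\<lambda>m. if m \<in> range \<phi> then ell2_nth x (inv \<phi> m) else 0)"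
  unfolding ell2_spread_def
proof (rule ell2_nth_Abs)
  have "summable (\<lambda>m. (cmod (if m \<in> range \<phi> then ell2_nth x (inv \<phi> m) else 0))\<^sup>2) \<longleftrightarrow>
      summable (\<lambda>k. (cmod (if \<phi> k \<in> range \<phi> then ell2_nth x (inv \<phi> (\<phi> k)) else 0))\<^sup>2)"
    by (rule summable_mono_reindex[OF assms, symmetric]) simp
  then show "summable (\<lambda>m. (cmod (if m \<in> range \<phi> then ell2_nth x (inv \<phi> m) else 0))\<^sup>2)"
    using summable_ell2_nth[of x] by (simp add: strict_mono_imp_inj_on[OF assms])
qed

lemma ell2_nth_spread:
  assumes "strict_mono \<phi>"
  shows "ell2_nth (ell2_spread \<phi> x) (\<phi> k) = ell2_nth x k"
    and "m \<notin> range \<phi> \<Longrightarrow> ell2_nth (ell2_spread \<phi> x) m = 0"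
  by (simp_all add: ell2_nth_spread_eq[OF assms] strict_mono_imp_inj_on[OF assms])

lemma ell2_spread_add: "strict_mono \<phi> \<Longrightarrow> ell2_spread \<phi> (x + y) = ell2_spread \<phi> x + ell2_spread \<phi> y"
  and ell2_spread_scaleC: "strict_mono \<phi> \<Longrightarrow> ell2_spread \<phi> (scaleC a x) = scaleC a (ell2_spread \<phi> x)"
  by (auto intro!: ell2_eqI simp: ell2_nth_spread_eq)

lemma cinner_ell2_spread:
  assumes "strict_mono \<phi>"
  shows "cinner (ell2_spread \<phi> x) (ell2_spread \<phi> y) = cinner x y"
  unfolding cinner_ell2_def
  by (subst suminf_mono_reindex[OF assms, symmetric]) (simp_all add: ell2_nth_spread[OF assms])

lemma cinner_ell2_spread_disjoint:
  assumes "strict_mono \<phi>" "strict_mono \<psi>" "range \<phi> \<inter> range \<psi> = {}"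
  shows "cinner (ell2_spread \<phi> x) (ell2_spread \<psi> y) = 0"
proof -
  have "ell2_nth (ell2_spread \<phi> x) m * cnj (ell2_nth (ell2_spread \<psi> y) m) = 0" for m
  proof (cases "m \<in> range \<phi>")
    case True
    then have "m \<notin> range \<psi>" using assms(3) by blast
    then show ?thesis by (simp add: ell2_nth_spread(2)[OF assms(2)])
  next
    case False
    then show ?thesis by (simp add: ell2_nth_spread(2)[OF assms(1)])
  qed
  then show ?thesis by (simp only: cinner_ell2_def suminf_zero)
qed

lemma norm_eq_of_cinner_eq: "cinner x x = cinner y y \<Longrightarrow> norm x = norm y"
  by (simp add: norm_eq_sqrt_inner inner_eq_Re_cinner)

lemma infsum_single_support:
  assumes "\<And>j. j \<in> A \<Longrightarrow> j \<noteq> i \<Longrightarrow> f j = 0"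
  shows "infsum f A = (if i \<in> A then f i else 0)"
proof -
  have "infsum f A = infsum f (A \<inter> {i})"
    using assms by (intro infsum_cong_neutral) auto
  then show ?thesis by simp
qed

text \<open>The span of the zeroth basis vector, described by coordinates so that closedness follows
  from continuity of the coordinate functionals.\<close>

definition ell2_line :: "ell2 set" where
  "ell2_line = {x. \<forall>m>0. ell2_nth x m = 0}"

definition ell2_first :: ell2 where
  "ell2_first = Abs_ell2 (\<lambda>m. if m = 0 then 1 else 0)"

lemma ell2_nth_first: "ell2_nth ell2_first m = (if m = 0 then 1 else 0)"
proof -
  have "summable (\<lambda>m. (cmod (if m = 0 then 1 else 0))\<^sup>2)"
    by (rule summable_finite[of "{0}"]) auto
  then show ?thesis unfolding ell2_first_def by (subst ell2_nth_Abs) simp_all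
qed

lemma ell2_first_in_line: "ell2_first \<in> ell2_line"
  by (simp add: ell2_line_def ell2_nth_first)

lemma norm_ell2_first: "norm ell2_first = 1"
proof -
  have "(\<Sum>i. (cmod (ell2_nth ell2_first i))\<^sup>2) = (\<Sum>i\<in>{0}. (cmod (ell2_nth ell2_first i))\<^sup>2)"
    by (rule suminf_finite) (simp_all add: ell2_nth_first)
  then have "(norm ell2_first)\<^sup>2 = 1" by (simp add: norm_ell2_sq ell2_nth_first)
  then show ?thesis by (metis norm_ge_zero one_power2 power2_eq_imp_eq zero_le_one)
qed

lemma closed_csubspace_ell2_line: "closed_csubspace ell2_line"
proof -
  have "bounded_linear (\<lambda>x. ell2_nth x m)" for m
    by (rule bounded_linear_intro[where K = 1]) (simp_all add: cmod_ell2_nth_le scaleR_conv_of_real)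
  then have "closed {x. ell2_nth x m = 0}" for m
    by (intro closed_Collect_eq linear_continuous_on continuous_on_const)
  then have "closed (\<Inter>m\<in>{0<..}. {x. ell2_nth x m = 0})" by (intro closed_INT ballI)
  moreover have "ell2_line = (\<Inter>m\<in>{0<..}. {x. ell2_nth x m = 0})" by (auto simp: ell2_line_def)
  ultimately have "closed ell2_line" by (simp only:)
  then show ?thesis by (simp add: closed_csubspace_def ell2_line_def)
qed

lemma ortho_proj_ell2_line: "ortho_proj ell2_line x = scaleC (ell2_nth x 0) ell2_first"
proof (rule ortho_proj_eqI[OF closed_csubspace_ell2_line])
  show "scaleC (ell2_nth x 0) ell2_first \<in> ell2_line"
    by (rule closed_csubspace_scaleC[OF closed_csubspace_ell2_line ell2_first_in_line])
  fix z assume "z \<in> ell2_line"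
  then have "ell2_nth (x - scaleC (ell2_nth x 0) ell2_first) i * cnj (ell2_nth z i) = 0" for i
    by (cases "i = 0") (simp_all add: ell2_line_def ell2_nth_first)
  then show "inner (x - scaleC (ell2_nth x 0) ell2_first) z = 0"
    by (simp only: inner_ell2_def suminf_zero zero_complex.simps)
qed

section \<open>The extremal example\<close>

text \<open>
  The shifted first argument makes \<open>0\<close> a fixed point of \<open>spread_index 1\<close>; subtraction is truncated,
  so the ranges are disjoint only for \<open>i \<ge> 1\<close>.
\<close>

definition spread_index :: "nat \<Rightarrow> nat \<Rightarrow> nat" where
  "spread_index i k = prod_encode (i - 1, k)"

lemma strict_mono_spread_index: "strict_mono (spread_index i)"
  by (rule strict_monoI_Suc) (simp add: spread_index_def prod_encode_def)

lemma spread_index_one_zero: "spread_index 1 0 = 0"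
  by (simp add: spread_index_def prod_encode_def)

lemma spread_index_disjoint:
  "1 \<le> i \<Longrightarrow> 1 \<le> j \<Longrightarrow> i \<noteq> j \<Longrightarrow> range (spread_index i) \<inter> range (spread_index j) = {}"
  by (auto simp: spread_index_def)

text \<open>Only values on \<open>ell2_line\<close> matter, so \<open>id\<close> stands for the
  identity of the line. Being trivial at all other indices, the example serves every
  \<open>n\<close>.\<close>

definition example_T :: "nat \<Rightarrow> ell2 \<Rightarrow> ell2" where
  "example_T i = (if i = 1 then id else (\<lambda>_. 0))"

definition example_V :: "nat \<Rightarrow> ell2 \<Rightarrow> ell2" where
  "example_V i = ell2_spread (spread_index i)"

definition example_X :: "nat \<Rightarrow> ell2 set" where
  "example_X i = (if i = 1 then ell2_line else {0})"

lemma cinner_example_V: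
  assumes "1 \<le> i" "1 \<le> j"
  shows "cinner (example_V i x) (example_V j y) = (if i = j then cinner x y else 0)"
  using cinner_ell2_spread_disjoint[OF strict_mono_spread_index strict_mono_spread_index
      spread_index_disjoint[OF assms]]
  by (simp add: example_V_def cinner_ell2_spread[OF strict_mono_spread_index])

text \<open>Among the indices from \<open>1\<close> on, only \<open>spread_index 1\<close> has
  \<open>0\<close> in its range, as a fixed point. This is the coordinate form of the lifting
  relation for \<open>ell2_line\<close>.\<close>

lemma ell2_nth_example_V_zero:
  assumes "1 \<le> i"
  shows "ell2_nth (example_V i x) 0 = (if i = 1 then ell2_nth x 0 else 0)"
proof (cases "i = 1")
  case True
  then show ?thesis
    using ell2_nth_spread(1)[OF strict_mono_spread_index, of 1 x 0, unfolded spread_index_one_zero]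
    by (simp add: example_V_def)
next
  case False
  have "0 \<notin> range (spread_index i)"
    using spread_index_disjoint[OF assms order_refl False] spread_index_one_zero by (metis IntI empty_iff rangeI)
  then show ?thesis using False by (simp add: example_V_def ell2_nth_spread(2)[OF strict_mono_spread_index])
qed

lemma example_V_first: "example_V 1 ell2_first = ell2_first"
proof (rule ell2_eqI)
  fix m
  show "ell2_nth (example_V 1 ell2_first) m = ell2_nth ell2_first m"
  proof (cases "m \<in> range (spread_index 1)")
    case True
    then obtain k where k: "m = spread_index 1 k" by blast
    have "m = 0 \<longleftrightarrow> k = 0"
      unfolding k using strict_mono_eq[OF strict_mono_spread_index, of 1 k 0] by (simp only: spread_index_one_zero)
    then show ?thesis
      using ell2_nth_spread(1)[OF strict_mono_spread_index, of 1 ell2_first k]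
      by (simp add: example_V_def ell2_nth_first k)
  next
    case False
    then have "m \<noteq> 0" using spread_index_one_zero by (metis rangeI)
    then show ?thesis
      using ell2_nth_spread(2)[OF strict_mono_spread_index False] by (simp add: example_V_def ell2_nth_first)
  qed
qed

lemma example_isometric_lifting: "isometric_lifting (index_set n) ell2_line example_T example_V"
  unfolding isometric_lifting_def
proof (intro conjI ballI allI)
  fix i x assume "i \<in> index_set n"
  then have i: "1 \<le> i" by (simp add: index_set_def)
  have "norm (example_V i y) = norm y" for y
    using cinner_example_V[OF i i, of y y] by (intro norm_eq_of_cinner_eq) simp
  then show "bounded_op UNIV UNIV (example_V i)"
    by (auto simp: bounded_op_def example_V_def ell2_spread_add ell2_spread_scaleC strict_mono_spread_index
        intro!: exI[of _ 1])
  show "ortho_proj ell2_line (example_V i x) = example_T i (ortho_proj ell2_line x)"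
    by (auto simp: ortho_proj_ell2_line ell2_nth_example_V_zero[OF i] example_T_def intro!: ell2_eqI)
  fix j assume "j \<in> index_set n"
  then have j: "1 \<le> j" by (simp add: index_set_def)
  show "adjoint_op UNIV (example_V i) (example_V j x) = (if i = j then x else 0)"
    unfolding adjoint_op_def cinner_example_V[OF i j]
  proof (rule the_equality)
    fix x' assume x': "x' \<in> UNIV \<and> (\<forall>z\<in>UNIV. (if i = j then cinner z x else 0) = cinner z x')"
    have "inner z (x' - (if i = j then x else 0)) = 0" for z
    proof -
      have "cinner z x' = (if i = j then cinner z x else 0)" using x' by simp
      then have "inner z x' = (if i = j then inner z x else 0)" by (simp add: inner_eq_Re_cinner)
      then show ?thesis by (simp add: inner_diff_right)
    qed
    then show "x' = (if i = j then x else 0)"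
      by (metis inner_eq_zero_iff right_minus_eq)
  qed (auto simp: cinner_eq_Complex scaleC_zero_right complex_eq_iff)
qed

lemma example_row_contraction: "row_contraction (index_set n) ell2_line example_T"
proof -
  have adj: "adjoint_op ell2_line (example_T i) h = (if i = 1 then h else 0)" if h: "h \<in> ell2_line" for i h
    unfolding adjoint_op_def
  proof (rule the_equality)
    show "(if i = 1 then h else 0) \<in> ell2_line \<and>
        (\<forall>z\<in>ell2_line. cinner (example_T i z) h = cinner z (if i = 1 then h else 0))"
      using h closed_csubspace_ell2_line
      by (auto simp: example_T_def closed_csubspace_def cinner_eq_Complex scaleC_zero_right complex_eq_iff)
    fix x' assume x': "x' \<in> ell2_line \<and> (\<forall>z\<in>ell2_line. cinner (example_T i z) h = cinner z x')"
    \<comment> \<open>The adjoint identity is tested on the difference \<open>?d\<close> itself,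
      which lies in the line; this forces \<open>?d = 0\<close>.\<close>
    let ?d = "x' - (if i = 1 then h else 0)"
    have "?d \<in> ell2_line"
      using x' h by (auto simp: ell2_line_def)
    then have "cinner (example_T i ?d) h = cinner ?d x'" using x' by blast
    then have "inner (example_T i ?d) h = inner ?d x'" by (simp add: inner_eq_Re_cinner)
    then have "inner ?d ?d = 0"
      by (simp add: example_T_def inner_diff_right split: if_splits)
    then show "x' = (if i = 1 then h else 0)" by simp
  qed
  have T0: "example_T i (adjoint_op ell2_line (example_T i) h) = (if i = 1 then h else 0)"
    if "h \<in> ell2_line" for i h
    unfolding adj[OF that] by (simp add: example_T_def)
  show ?thesis
    unfolding row_contraction_def
  proof (intro conjI ballI)
    show "bounded_op ell2_line ell2_line (example_T i)" for i
      using closed_csubspace_ell2_line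
      by (auto simp: bounded_op_def example_T_def closed_csubspace_def scaleC_zero_right intro!: exI[of _ 1])
    fix h assume h: "h \<in> ell2_line"
    have "finite (index_set n \<inter> {1})" by simp
    then have "(\<lambda>i. if i = 1 then h else 0) summable_on (index_set n \<inter> {1})" by (rule summable_on_finite)
    then show "(\<lambda>i. example_T i (adjoint_op ell2_line (example_T i) h)) summable_on index_set n"
      unfolding T0[OF h] by (rule iffD1[OF summable_on_cong_neutral, rotated -1]) auto
    have "(\<Sum>\<^sub>\<infinity>i\<in>index_set n. if i = 1 then h else 0) = (if 1 \<in> index_set n then h else 0)"
      by (subst infsum_single_support[of _ 1]) auto
    then show "Re (cinner (\<Sum>\<^sub>\<infinity>i\<in>index_set n. example_T i (adjoint_op ell2_line (example_T i) h)) h)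
        \<le> Re (cinner h h)"
      unfolding T0[OF h] by (simp flip: inner_eq_Re_cinner)
  qed
qed

lemma closed_csubspace_example_X: "closed_csubspace (example_X i)"
  using closed_csubspace_ell2_line by (auto simp: example_X_def closed_csubspace_def scaleC_zero_right)

lemma example_lifting_data:
  "lifting_data n ell2_line example_T example_V example_X (\<lambda>i x. - x) (ortho_proj ell2_line)"
  unfolding lifting_data_def
proof (intro conjI ballI impI closed_csubspace_ell2_line example_row_contraction
    example_isometric_lifting closed_csubspace_example_X)
  show "orthogonal_spaces (example_X i) (example_X j)" if "i \<noteq> j" for i j
    using that by (auto simp: orthogonal_spaces_def example_X_def cinner_eq_Complex scaleC_zero_right complex_eq_iff)
  show "contraction_op (example_X i) UNIV uminus" for i
    using closed_csubspace_example_X[of i]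
    by (intro contraction_opI) (auto simp: scaleC_minus_right closed_csubspace_def)
  show "contraction_op UNIV ell2_line (ortho_proj ell2_line)"
    by (intro contraction_opI ortho_proj(1) norm_ortho_proj_le ortho_proj_scaleC closed_csubspace_ell2_line
        linear_add[OF ortho_proj_linear]) simp
qed

text \<open>Only the entry at \<open>1\<close> acts on a nonzero space; on the unit ball it is a
  difference of two vectors of norm at most \<open>1\<close>.\<close>

lemma example_row_norm:
  fixes n :: enat
  defines "\<delta> \<equiv> row_norm (index_set n) example_X
      (\<lambda>i x. example_T i (ortho_proj ell2_line (- x)) - ortho_proj ell2_line x)"
  shows "0 \<le> \<delta>" "\<delta> \<le> 2"
proof -
  note proj0 = linear_0[OF ortho_proj_linear[OF closed_csubspace_ell2_line]]
  have "norm (row_op (index_set n) (\<lambda>i x. example_T i (ortho_proj ell2_line (- x)) - ortho_proj ell2_line x) x) \<le> 2"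
    if x: "x \<in> direct_sum (index_set n) example_X" "direct_sum_norm (index_set n) x \<le> 1" for x
  proof -
    have x0: "x i = 0" if "i \<in> index_set n" "i \<noteq> 1" for i
      using x(1) that by (auto simp: direct_sum_def example_X_def)
    have "(\<Sum>\<^sub>\<infinity>i\<in>index_set n. (norm (x i))\<^sup>2) = (if 1 \<in> index_set n then (norm (x 1))\<^sup>2 else 0)"
      using x0 by (intro infsum_single_support) auto
    then have norm1: "1 \<in> index_set n \<Longrightarrow> norm (x 1) \<le> 1"
      using x(2) by (simp add: direct_sum_norm_def)
    have "row_op (index_set n) (\<lambda>i x. example_T i (ortho_proj ell2_line (- x)) - ortho_proj ell2_line x) x =
        (if 1 \<in> index_set n then example_T 1 (ortho_proj ell2_line (- x 1)) - ortho_proj ell2_line (x 1) else 0)"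
      unfolding row_op_def using x0 by (intro infsum_single_support) (auto simp: proj0 example_T_def)
    also have "norm \<dots> \<le> 2"
    proof (cases "1 \<in> index_set n")
      case True
      show ?thesis
        using norm1[OF True] True
          norm_triangle_ineq4[of "ortho_proj ell2_line (- x 1)" "ortho_proj ell2_line (x 1)"]
          norm_ortho_proj_le[OF closed_csubspace_ell2_line, of "- x 1"]
          norm_ortho_proj_le[OF closed_csubspace_ell2_line, of "x 1"]
        by (simp add: example_T_def)
    qed simp
    finally show ?thesis .
  qed
  moreover have "0 \<in> example_X i" for i
    using closed_csubspace_example_X by (auto simp: closed_csubspace_def)
  ultimately show "0 \<le> \<delta>" "\<delta> \<le> 2"
    unfolding \<delta>_def by (intro row_norm_bounds[where C = 2]; blast)+
qed

text \<open>\<open>B\<close> must fix \<open>ell2_first\<close>: its component along the line is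
  prescribed, and a contraction leaves no norm for an orthogonal component. As
  \<open>example_V 1\<close> fixes this unit vector too, the sign change produces \<open>-2\<close>
  times it.\<close>

lemma example_op_norm:
  assumes B: "contraction_op UNIV UNIV B" and PB: "\<And>x. ortho_proj ell2_line (B x) = ortho_proj ell2_line x"
  shows "2 \<le> op_norm (example_X 1) (\<lambda>x. example_V 1 (B (- x)) - B x)"
proof -
  note H = closed_csubspace_ell2_line
  have B_norm: "norm (B x) \<le> norm x" for x
    by (rule contraction_op_norm_le[OF closed_csubspace_UNIV B UNIV_I])
  have "bounded_op UNIV UNIV B" using B by (simp add: contraction_op_def)
  then have B_lin: "linear B" by (rule bounded_linear.linear[OF bounded_op_UNIV_bounded_linear])
  have V_norm: "norm (example_V 1 x) = norm x" for x
    using cinner_example_V[of 1 1 x x] by (intro norm_eq_of_cinner_eq) simp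
  let ?u = ell2_first
  have Pu: "ortho_proj ell2_line (B ?u) = ?u"
    by (simp add: PB ortho_proj_self[OF H ell2_first_in_line])
  have "inner (B ?u - ?u) ?u = 0"
    using ortho_proj(2)[OF H ell2_first_in_line, of "B ?u"] by (simp add: Pu)
  then have "(norm (?u + (B ?u - ?u)))\<^sup>2 = (norm ?u)\<^sup>2 + (norm (B ?u - ?u))\<^sup>2"
    by (intro norm_add_Pythagorean) (simp add: orthogonal_def inner_commute)
  moreover have "(norm (B ?u))\<^sup>2 \<le> (norm ?u)\<^sup>2" using B_norm by (intro power_mono) auto
  ultimately have Bu: "B ?u = ?u" by simp
  have "example_V 1 (B (- ?u)) = - ?u"
  proof -
    have "scaleC (-1) ?u = - ?u" using scaleR_eq_scaleC[of "-1" ?u] by simp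
    moreover have "example_V 1 (scaleC (-1) ?u) = scaleC (-1) (example_V 1 ?u)"
      unfolding example_V_def by (rule ell2_spread_scaleC[OF strict_mono_spread_index])
    ultimately show ?thesis by (simp only: linear_neg[OF B_lin] Bu example_V_first)
  qed
  then have "norm (example_V 1 (B (- ?u)) - B ?u) = norm ((-2) *\<^sub>R ?u)"
    by (simp add: Bu scaleR_2)
  then have "2 = norm (example_V 1 (B (- ?u)) - B ?u)" by (simp add: norm_ell2_first)
  also have "\<dots> \<le> op_norm (example_X 1) (\<lambda>x. example_V 1 (B (- x)) - B x)"
  proof (rule op_norm_upper[where c = 2])
    fix x :: ell2 assume "norm x \<le> 1"
    then show "norm (example_V 1 (B (- x)) - B x) \<le> 2"
      using norm_triangle_ineq4[of "example_V 1 (B (- x))" "B x"] B_norm[of x] B_norm[of "- x"]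
      unfolding V_norm norm_minus_cancel by linarith
  qed (simp_all add: example_X_def ell2_first_in_line norm_ell2_first)
  finally show ?thesis .
qed

theorem theorem1p1:
  fixes n :: enat
  assumes "1 \<le> n"
  shows
    "(\<forall>(H :: 'k::complex_hilbert_space set) T V (X :: nat \<Rightarrow> 'x::complex_hilbert_space set) R A.
        lifting_data n H T V X R A \<longrightarrow>
        (\<exists>B. contraction_op UNIV UNIV B \<and> (\<forall>x. ortho_proj H (B x) = A x) \<and>
          (\<forall>i\<in>index_set n.
             op_norm (X i) (\<lambda>x. V i (B (R i x)) - B x)
               \<le> sqrt 2 * sqrt (row_norm (index_set n) X (\<lambda>i x. T i (A (R i x)) - A x))))) \<and>
     (\<forall>c < sqrt 2.
        \<not> (\<forall>(H :: ell2 set) T V (X :: nat \<Rightarrow> ell2 set) R A.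
            lifting_data n H T V X R A \<longrightarrow>
            (\<exists>B. contraction_op UNIV UNIV B \<and> (\<forall>x. ortho_proj H (B x) = A x) \<and>
              (\<forall>i\<in>index_set n.
                 op_norm (X i) (\<lambda>x. V i (B (R i x)) - B x)
                   \<le> c * sqrt (row_norm (index_set n) X (\<lambda>i x. T i (A (R i x)) - A x))))))"
proof (intro conjI allI impI notI)
  fix H :: "'k set" and T V and X :: "nat \<Rightarrow> 'x set" and R A
  assume "lifting_data n H T V X R A"
  then show "\<exists>B. contraction_op UNIV UNIV B \<and> (\<forall>x. ortho_proj H (B x) = A x) \<and>
          (\<forall>i\<in>index_set n.
             op_norm (X i) (\<lambda>x. V i (B (R i x)) - B x)
               \<le> sqrt 2 * sqrt (row_norm (index_set n) X (\<lambda>i x. T i (A (R i x)) - A x)))"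
    by (rule approximate_lifting)
next
  fix c :: real
  assume c: "c < sqrt 2"
  assume all: "\<forall>(H :: ell2 set) T V (X :: nat \<Rightarrow> ell2 set) R A.
            lifting_data n H T V X R A \<longrightarrow>
            (\<exists>B. contraction_op UNIV UNIV B \<and> (\<forall>x. ortho_proj H (B x) = A x) \<and>
              (\<forall>i\<in>index_set n.
                 op_norm (X i) (\<lambda>x. V i (B (R i x)) - B x)
                   \<le> c * sqrt (row_norm (index_set n) X (\<lambda>i x. T i (A (R i x)) - A x))))"
  define \<delta> where "\<delta> = row_norm (index_set n) example_X
      (\<lambda>i x. example_T i (ortho_proj ell2_line (- x)) - ortho_proj ell2_line x)"
  have \<delta>: "0 \<le> \<delta>" "\<delta> \<le> 2" unfolding \<delta>_def by (rule example_row_norm)+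
  \<comment> \<open>\<open>1 \<le> n\<close> puts the one index that carries the example into the
    index set.\<close>
  have one: "1 \<in> index_set n" using assms by (simp add: index_set_def one_enat_def)
  obtain B where "contraction_op UNIV UNIV B" "\<And>x. ortho_proj ell2_line (B x) = ortho_proj ell2_line x"
    "op_norm (example_X 1) (\<lambda>x. example_V 1 (B (- x)) - B x) \<le> c * sqrt \<delta>"
    using all[rule_format, OF example_lifting_data] one unfolding \<delta>_def by blast
  \<comment> \<open>The example forces the error to be at least \<open>2\<close>, while
    \<open>\<delta> \<le> 2\<close> and \<open>c < sqrt 2\<close> keep the claimed bound below
    \<open>2\<close>. A nonpositive \<open>c\<close> is treated apart because the monotonicity step
    needs a nonnegative factor.\<close>
  then have "2 \<le> c * sqrt \<delta>" using example_op_norm[of B] order_trans by blast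
  also have "\<dots> < 2"
  proof (cases "c \<le> 0")
    case True
    then show ?thesis using \<delta>(1) mult_nonpos_nonneg[of c "sqrt \<delta>"] by simp
  next
    case False
    then have "c * sqrt \<delta> \<le> c * sqrt 2" using \<delta>(2) by (intro mult_left_mono) auto
    also have "\<dots> < sqrt 2 * sqrt 2" using c by (intro mult_strict_right_mono) auto
    finally show ?thesis by simp
  qed
  finally show False by simp
qed

end
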